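(* Let $A=(a_{ij})$ be a real symmetric matrix of order $n$, let $\Delta_A=\sum_{i,j=1}^n a_{ij}\frac{\partial^2}{\partial x_i\partial x_j}$ on $\mathbb{R}^n$, and let $w$ be a solution to the Schrödinger equation $$\frac{\partial w}{\partial t}(x,t)-i\Delta_A w(x,t)=0,\quad (x,t)\in\mathbb{R}^n\times\mathbb{R},\qquad w(x,0)=f(x),\quad x\in\mathbb{R}^n .$$ Let $\psi:\mathbb{R}^n\to[0,\infty)$ be a non-negative, locally integrable, radial function. Assume that $f\in C_c^\infty(\mathbb{R}^n)$ and that for some $t_0\neq 0$ and some constant $C$, $$|w(x,t_0)|\le C e^{-\psi(x)}\quad\text{for all } x\in\mathbb{R}^n .$$ If $$\int_0^\infty\frac{\psi(r)}{1+r^2}\,dr=\infty,$$ then $w=0$.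
   Context: The solution is understood as $w(x,t)=e^{it\Delta_A}f(x)$, i.e. $w(\cdot,t)$ has Fourier transform $e^{-4\pi^2 it\sum_{i,j}a_{ij}\xi_i\xi_j}\widehat f(\xi)$, where $\widehat f(\xi)=\int_{\mathbb{R}^n}f(x)e^{-2\pi i x\cdot\xi}\,dx$. $C_c^\infty(\mathbb{R}^n)$ is the set of compactly supported smooth functions on $\mathbb{R}^n$. A radial function on $\mathbb{R}^n$ is also viewed as a function $\psi(r)$ of $r=|x|\in[0,\infty)$.
   Formalization: The claim fails for A=0 (then w(x,t)=f(x)) and can fail for singular A if the integral diverges only at r=0; so A≠0 is assumed and, when det A=0, the integral of ψ(r)/(1+r²) is assumed to diverge already over [1,∞). *)

theory Defs
  imports "HOL-Analysis.Analysis"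
begin

primrec Ck :: "nat \<Rightarrow> ('a::real_normed_vector \<Rightarrow> 'b::real_normed_vector) \<Rightarrow> bool" where
  "Ck 0 f \<longleftrightarrow> continuous_on UNIV f"
| "Ck (Suc k) f \<longleftrightarrow> (\<forall>x. f differentiable (at x)) \<and>
     (\<forall>v. Ck k (\<lambda>x. frechet_derivative f (at x) v))"

definition Cc_infinity :: "('a::real_normed_vector \<Rightarrow> 'b::real_normed_vector) \<Rightarrow> bool" where
  "Cc_infinity f \<longleftrightarrow> (\<forall>k. Ck k f) \<and> compact (closure {x. f x \<noteq> 0})"

definition partial_deriv :: "'n \<Rightarrow> (real^'n::finite \<Rightarrow> complex) \<Rightarrow> real^'n \<Rightarrow> complex" where
  "partial_deriv i u x = frechet_derivative u (at x) (axis i 1)"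

definition Laplacian :: "real^'n^'n \<Rightarrow> (real^'n::finite \<Rightarrow> complex) \<Rightarrow> real^'n \<Rightarrow> complex" where
  "Laplacian A u x =
     (\<Sum>i\<in>UNIV. \<Sum>j\<in>UNIV. complex_of_real (A $ i $ j) * partial_deriv i (partial_deriv j u) x)"

definition fourier :: "(real^'n::finite \<Rightarrow> complex) \<Rightarrow> real^'n \<Rightarrow> complex" where
  "fourier f \<xi> = (LINT x|lborel. f x * exp (- 2 * of_real pi * \<i> * of_real (x \<bullet> \<xi>)))"

(* The last conjunct says that w(-,t) is exp (i t Laplacian_A) f.  For f in Cc_infinity that
   function is Schwartz in x and solves the equation classically, so the C^2 and integrability
   conditions exclude nothing.  They are needed because frechet_derivative is unspecified at points
   of non-differentiability, because the Lebesgue integral of a non-integrable function is 0, and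
   because the Fourier transform determines w(-,t) only almost everywhere. *)
definition schroedinger_solution ::
    "real^'n^'n \<Rightarrow> (real^'n::finite \<Rightarrow> complex) \<Rightarrow> (real^'n \<Rightarrow> real \<Rightarrow> complex) \<Rightarrow> bool" where
  "schroedinger_solution A f w \<longleftrightarrow>
     (\<forall>t. Ck 2 (\<lambda>x. w x t)) \<and>
     (\<forall>x t. (\<lambda>s. w x s) differentiable (at t) \<and>
        vector_derivative (\<lambda>s. w x s) (at t) - \<i> * Laplacian A (\<lambda>y. w y t) x = 0) \<and>
     (\<forall>x. w x 0 = f x) \<and>
     (\<forall>t. integrable lborel (\<lambda>x. w x t) \<and>
        (\<forall>\<xi>. fourier (\<lambda>x. w x t) \<xi> =
           exp (- 4 * of_real (pi\<^sup>2) * \<i> * of_real t *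
                of_real (\<Sum>i\<in>UNIV. \<Sum>j\<in>UNIV. A $ i $ j * \<xi> $ i * \<xi> $ j)) * fourier f \<xi>))"

definition locally_integrable :: "(real^'n::finite \<Rightarrow> real) \<Rightarrow> bool" where
  "locally_integrable g \<longleftrightarrow> (\<forall>K. compact K \<longrightarrow> g absolutely_integrable_on K)"

end

theory Submission
  imports Defs "HOL-Probability.Probability" "HOL-Complex_Analysis.Complex_Analysis"
begin

text \<open>
  Write \<open>u\<close> for the solution at time \<open>t\<^sub>0\<close>.  A rotation, which changes neither Lebesgue measure nor a
  radial bound, makes the quadratic form of \<open>A\<close> diagonal, so that the evolution multiplies the Fourier
  transform of \<open>f\<close> by \<open>exp (- \<i> \<Sum> \<tau>\<^sub>i \<xi>\<^sub>i\<^sup>2)\<close> with real \<open>\<tau>\<^sub>i\<close>.  In a coordinate with \<open>\<tau>\<^sub>i \<noteq> 0\<close> this is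
  convolution with a constant times \<open>exp (\<i> \<pi>\<^sup>2 z\<^sup>2 / \<tau>\<^sub>i)\<close>.  Expanding the square in \<open>(x - y)\<^sup>2\<close> shows
  that, up to a unimodular quadratic factor, \<open>u\<close> depends on \<open>x\<close> only through the characters
  \<open>exp (- 2 \<i> \<pi>\<^sup>2 x y / \<tau>\<^sub>i)\<close>, integrated over the compact support of \<open>f\<close>.  Hence on every line whose
  direction only involves such coordinates, \<open>\<bar>u\<bar>\<close> is the modulus of an entire function \<open>H\<close> with
  \<open>\<bar>H z\<bar> \<le> K exp (S \<bar>Im z\<bar>)\<close> (\<open>schroedinger_extends_along_lines\<close>).  The oscillating kernels are
  reached as limits of the Gaussians with \<open>\<tau>\<^sub>i\<close> replaced by \<open>\<tau>\<^sub>i - \<i> \<epsilon>\<close>; normal families make the limit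
  entire, and this treats zero and nonzero \<open>\<tau>\<^sub>i\<close> alike.

  A nonzero function of this kind has a finite logarithmic integral on the real line: multiplied by
  \<open>exp (\<i> S z)\<close> it is bounded in the upper half plane, and Jensen's inequality, transported from the
  disk by the Cayley transform, bounds the Poisson integral of \<open>- ln \<bar>H\<bar>\<close>.  On the line at distance
  \<open>b\<close> from the origin the hypothesis gives \<open>- ln \<bar>H s\<bar> \<ge> \<rho> (sqrt (s\<^sup>2 + b\<^sup>2)) - const\<close>, and the
  substitution \<open>r = sqrt (s\<^sup>2 + b\<^sup>2)\<close> shows that \<open>H\<close> vanishes as soon as \<open>\<integral> \<rho> r / (1 + r\<^sup>2)\<close> diverges
  over \<open>(b, \<infinity>)\<close> (\<open>exponential_type_vanishes_if_log_integral_diverges\<close>).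

  If the divergence occurs at infinity, local integrability of \<open>\<psi>\<close> makes it persist over every
  \<open>(b, \<infinity>)\<close>, and all lines parallel to one eigenvector with nonzero eigenvalue sweep out the space.
  Otherwise the divergence is at the origin and \<open>A\<close> is nondegenerate; then every direction is
  admissible, and the lines through the origin suffice.  So \<open>u = 0\<close>, and injectivity of the Fourier
  transform gives \<open>f = 0\<close> and \<open>w = 0\<close>.
\<close>

section \<open>Diagonalization of symmetric matrices and rotation of Lebesgue measure\<close>

lemma symmetric_inner_matrix:
  fixes A :: "real^'n^'n"
  assumes "transpose A = A"
  shows "x \<bullet> (A *v y) = (A *v x) \<bullet> y"
  using assms by (metis dot_lmul_matrix vector_transpose_matrix)

text \<open>
  A unit vector \<open>v\<close> of the invariant subspace that maximizes the Rayleigh quotient is an eigenvector: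
  with \<open>r = A v - \<mu> v\<close>, maximality along \<open>v + t r\<close> reads \<open>2 t (r \<bullet> r) + O(t\<^sup>2) \<le> 0\<close>, and letting \<open>t\<close>
  be small and positive forces \<open>r = 0\<close>.
\<close>

lemma rayleigh_maximizer_is_eigenvector:
  fixes A :: "real^'n^'n"
  assumes A: "transpose A = A" and W: "subspace W" "\<And>w. w \<in> W \<Longrightarrow> A *v w \<in> W" "W \<noteq> {0}"
  obtains v \<mu> where "v \<in> W" "norm v = 1" "A *v v = \<mu> *\<^sub>R v"
proof -
  let ?S = "sphere 0 1 \<inter> W"
  have "compact ?S" using W(1) by (intro compact_Int_closed closed_subspace) auto
  moreover have "?S \<noteq> {}"
  proof -
    obtain w where w: "w \<in> W" "w \<noteq> 0" using W subspace_0 by blast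
    hence "w /\<^sub>R norm w \<in> ?S" using subspace_scale[OF W(1)] by auto
    thus ?thesis by blast
  qed
  moreover have "continuous_on ?S (\<lambda>x. x \<bullet> (A *v x))"
    by (intro continuous_intros matrix_vector_mult_linear_continuous_on)
  ultimately have "\<exists>v\<in>?S. \<forall>x\<in>?S. x \<bullet> (A *v x) \<le> v \<bullet> (A *v v)"
    by (rule continuous_attains_sup)
  then obtain v where v: "v \<in> ?S" "\<And>x. x \<in> ?S \<Longrightarrow> x \<bullet> (A *v x) \<le> v \<bullet> (A *v v)"
    by auto
  define \<mu> where "\<mu> = v \<bullet> (A *v v)"
  have nv: "norm v = 1" "v \<in> W" "v \<bullet> v = 1" using v(1) by (auto simp: norm_eq_1)
  have max: "x \<bullet> (A *v x) \<le> \<mu> * (x \<bullet> x)" if "x \<in> W" for x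
  proof (cases "x = 0")
    case False
    have "(x /\<^sub>R norm x) \<bullet> (A *v (x /\<^sub>R norm x)) \<le> \<mu>"
      unfolding \<mu>_def using False that subspace_scale[OF W(1)] by (intro v(2)) auto
    hence "(x \<bullet> (A *v x)) / (norm x)\<^sup>2 \<le> \<mu>"
      by (simp add: matrix_vector_mult_scaleR divide_inverse power2_eq_square mult_ac)
    thus ?thesis using False by (simp add: field_simps power2_norm_eq_inner)
  qed auto
  define r where "r = A *v v - \<mu> *\<^sub>R v"
  have r: "r \<in> W" unfolding r_def using W nv by (intro subspace_diff subspace_scale) auto
  have "r \<bullet> r = 0"
  proof (rule ccontr)
    assume "r \<bullet> r \<noteq> 0"
    hence pos: "r \<bullet> r > 0" using inner_ge_zero[of r] by linarith
    define c where "c = r \<bullet> (A *v r) - \<mu> * (r \<bullet> r)"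
    have ineq: "2 * t * (r \<bullet> r) + t\<^sup>2 * c \<le> 0" for t
    proof -
      have "v + t *\<^sub>R r \<in> W" using nv r W by (intro subspace_add subspace_scale) auto
      from max[OF this]
      have "\<mu> + t * (v \<bullet> (A *v r)) + t * (r \<bullet> (A *v v)) + t\<^sup>2 * (r \<bullet> (A *v r)) \<le>
          \<mu> * (1 + 2 * t * (v \<bullet> r) + t\<^sup>2 * (r \<bullet> r))"
        by (simp add: matrix_vector_right_distrib matrix_vector_mult_scaleR inner_add_left inner_add_right
           nv(3) \<mu>_def[symmetric] power2_eq_square algebra_simps inner_commute[of r v])
      moreover have "v \<bullet> (A *v r) = r \<bullet> (A *v v)"
        using symmetric_inner_matrix[OF A] by (simp add: inner_commute)
      moreover have "r \<bullet> (A *v v) = r \<bullet> r + \<mu> * (v \<bullet> r)"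
        unfolding r_def by (simp add: inner_diff_left inner_diff_right inner_commute algebra_simps)
      ultimately show ?thesis by (simp add: c_def algebra_simps)
    qed
    \<comment> \<open>Small enough that the quadratic term cannot compensate the linear one.\<close>
    define t where "t = (r \<bullet> r) / (1 + \<bar>c\<bar>)"
    have t: "t > 0" using pos by (auto simp: t_def add_pos_nonneg)
    have "t * (2 * (r \<bullet> r) + t * c) \<le> 0"
      using ineq[of t] by (simp add: algebra_simps power2_eq_square)
    hence "2 * (r \<bullet> r) + t * c \<le> 0" using t by (simp add: mult_le_0_iff)
    moreover have "t * \<bar>c\<bar> \<le> r \<bullet> r"
      using pos by (simp add: t_def field_simps)
    moreover have "- (t * \<bar>c\<bar>) \<le> t * c" using t by (simp add: abs_if)
    ultimately show False using pos by linarith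
  qed
  hence "A *v v = \<mu> *\<^sub>R v" by (simp add: r_def)
  thus ?thesis using nv that by blast
qed

text \<open>
  The orthogonal complement of eigenvectors already found is invariant under the symmetric \<open>A\<close>, so it
  contains a further eigenvector as long as it is nonzero.
\<close>

lemma orthonormal_eigenvectors:
  fixes A :: "real^'n^'n"
  assumes A: "transpose A = A" and k: "k \<le> CARD('n)"
  shows "\<exists>S. finite S \<and> card S = k \<and> pairwise orthogonal S \<and>
             (\<forall>v\<in>S. norm v = 1 \<and> (\<exists>\<mu>. A *v v = \<mu> *\<^sub>R v))"
  using k
proof (induction k)
  case 0
  show ?case by (intro exI[of _ "{}"]) auto
next
  case (Suc k)
  then obtain S where S: "finite S" "card S = k" "pairwise orthogonal S"
      "\<And>v. v \<in> S \<Longrightarrow> norm v = 1" "\<And>v. v \<in> S \<Longrightarrow> \<exists>\<mu>. A *v v = \<mu> *\<^sub>R v" by auto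
  define W where "W = {x. \<forall>v\<in>S. v \<bullet> x = 0}"
  have W: "subspace W" unfolding W_def
    by (auto simp: subspace_def inner_add_right)
  have "span S \<noteq> UNIV"
  proof
    assume "span S = UNIV"
    hence "dim (UNIV :: (real^'n) set) \<le> card S" using S(1) by (metis dim_le_card' dim_span)
    thus False using Suc.prems S(2) by simp
  qed
  then obtain w where w: "w \<noteq> 0" "\<And>x. x \<in> span S \<Longrightarrow> orthogonal w x"
    using orthogonal_to_subspace_exists_gen[of S UNIV] by (metis psubsetI span_UNIV subset_UNIV)
  have "w \<in> W" unfolding W_def using w(2) span_base by (auto simp: orthogonal_def inner_commute)
  hence W0: "W \<noteq> {0}" using w by auto
  have inv: "A *v x \<in> W" if "x \<in> W" for x
  proof -
    have "v \<bullet> (A *v x) = 0" if v: "v \<in> S" for v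
    proof -
      obtain \<mu> where "A *v v = \<mu> *\<^sub>R v" using S(5)[OF v] by blast
      thus ?thesis using v \<open>x \<in> W\<close> by (simp add: symmetric_inner_matrix[OF A] W_def)
    qed
    thus ?thesis by (simp add: W_def)
  qed
  obtain v \<mu> where v: "v \<in> W" "norm v = 1" "A *v v = \<mu> *\<^sub>R v"
    using rayleigh_maximizer_is_eigenvector[OF A W inv W0] by blast
  have "v \<notin> S"
  proof
    assume "v \<in> S"
    hence "v \<bullet> v = 0" using v(1) by (simp add: W_def)
    thus False using v(2) by auto
  qed
  have "orthogonal v s" "orthogonal s v" if "s \<in> S" for s
    using v(1) that by (auto simp: W_def orthogonal_def inner_commute)
  thus ?case using S v \<open>v \<notin> S\<close>
    by (intro exI[of _ "insert v S"]) (auto simp: pairwise_insert)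
qed

lemma symmetric_diagonalization:
  fixes A :: "real^'n^'n"
  assumes A: "transpose A = A"
  obtains P :: "real^'n \<Rightarrow> real^'n" and \<mu> :: "'n \<Rightarrow> real"
  where "orthogonal_transformation P" "\<And>i. A *v P (axis i 1) = \<mu> i *\<^sub>R P (axis i 1)"
    "\<And>x. P x \<bullet> (A *v P x) = (\<Sum>i\<in>UNIV. \<mu> i * (x $ i)\<^sup>2)"
proof -
  obtain S where S: "finite S" "card S = CARD('n)" "pairwise orthogonal S"
      "\<And>v. v \<in> S \<Longrightarrow> norm v = 1" "\<And>v. v \<in> S \<Longrightarrow> \<exists>\<mu>. A *v v = \<mu> *\<^sub>R v"
    using orthonormal_eigenvectors[OF A order_refl] by auto
  obtain b where b: "bij_betw b (UNIV :: 'n set) S"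
    using finite_same_card_bij[of "UNIV::'n set" S] S by auto
  have bS: "b i \<in> S" for i using b by (auto simp: bij_betw_def)
  have bb: "b i \<bullet> b j = (if i = j then 1 else 0)" for i j
  proof (cases "i = j")
    case True
    thus ?thesis using S(4)[OF bS] by (simp add: norm_eq_1)
  next
    case False
    hence "b i \<noteq> b j" using b by (metis bij_betw_imp_inj_on injD)
    thus ?thesis using S(3) bS False by (simp add: pairwise_def orthogonal_def)
  qed
  define P where "P = (\<lambda>x::real^'n. \<Sum>i\<in>UNIV. x $ i *\<^sub>R b i)"
  have "linear P" unfolding P_def by (intro linearI) (auto simp: scaleR_left_distrib sum.distrib scaleR_sum_right)
  moreover have ip: "P x \<bullet> P y = x \<bullet> y" for x y
  proof -
    have "P x \<bullet> P y = (\<Sum>i\<in>UNIV. x $ i * y $ i)"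
      by (simp add: P_def inner_sum_left inner_sum_right bb if_distrib mult_ac cong: if_cong)
    thus ?thesis by (simp add: inner_vec_def)
  qed
  ultimately have "orthogonal_transformation P" by (simp add: orthogonal_transformation_def)
  moreover have Pa: "P (axis i 1) = b i" for i
    by (simp add: P_def axis_def if_distrib[of "\<lambda>x. x *\<^sub>R _"] cong: if_cong)
  obtain \<mu> where \<mu>: "\<And>i. A *v b i = \<mu> i *\<^sub>R b i"
    using S(5)[OF bS] by metis
  have "P x \<bullet> (A *v P x) = (\<Sum>i\<in>UNIV. \<mu> i * (x $ i)\<^sup>2)" for x
  proof -
    have "A *v P x = (\<Sum>i\<in>UNIV. (x $ i * \<mu> i) *\<^sub>R b i)"
      unfolding P_def by (simp add: linear_sum[OF matrix_vector_mul_linear] matrix_vector_mult_scaleR \<mu> o_def)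
    thus ?thesis
      by (simp add: P_def inner_sum_left inner_sum_right bb if_distrib power2_eq_square mult_ac cong: if_cong)
  qed
  ultimately show ?thesis using that[of P \<mu>] \<mu> Pa by simp
qed

lemma borel_measurable_orthogonal_transformation:
  "orthogonal_transformation (P :: 'a::euclidean_space \<Rightarrow> 'a) \<Longrightarrow> P \<in> borel_measurable borel"
  by (intro borel_measurable_continuous_onI linear_continuous_on linear_conv_bounded_linear[THEN iffD1] 
    orthogonal_transformation_linear)

lemma nn_integral_lborel_shift:
  fixes c :: "'a::euclidean_space"
  assumes [measurable]: "f \<in> borel_measurable borel"
  shows "(\<integral>\<^sup>+x. f (c + x) \<partial>lborel) = (\<integral>\<^sup>+x. f x \<partial>lborel)"
  by (subst (2) lborel_distr_plus[of c, symmetric], subst nn_integral_distr) auto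

text \<open>
  The image of Lebesgue measure under \<open>P\<close> is translation invariant and gives the unit ball \<open>B\<close> its
  Lebesgue measure, and these properties determine it: computing
  \<open>\<integral>\<integral> 1\<^sub>B(y) 1\<^sub>X(P x + y) dx dy\<close> in both orders yields \<open>\<bar>B\<bar> \<bar>P\<^sup>-\<^sup>1 X\<bar>\<close> and \<open>\<bar>B\<bar> \<bar>X\<bar>\<close>.
\<close>

lemma distr_lborel_orthogonal:
  fixes P :: "'a::euclidean_space \<Rightarrow> 'a"
  assumes P: "orthogonal_transformation P"
  shows "distr lborel borel P = lborel"
proof (rule measure_eqI)
  fix X assume "X \<in> sets (distr lborel borel P)"
  hence X[measurable]: "X \<in> sets borel" by simp
  have Pm[measurable]: "P \<in> borel_measurable borel" by (rule borel_measurable_orthogonal_transformation[OF P])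
  define Q where "Q = inv P"
  have Q: "orthogonal_transformation Q" "\<And>y. P (Q y) = y" "\<And>x. Q (P x) = x"
    using P orthogonal_transformation_inv[OF P] orthogonal_transformation_bij[OF P]
    by (auto simp: Q_def bij_is_surj surj_f_inv_f bij_is_inj)
  let ?B = "cball (0::'a) 1"
  let ?b = "\<lambda>y. indicator ?B y :: ennreal" and ?x = "\<lambda>y. indicator X y :: ennreal"
  have bm[measurable]: "?b \<in> borel_measurable borel" by (intro borel_measurable_indicator) auto
  have lin: "P (x + y) = P x + P y" "Q (x + y) = Q x + Q y" "P (x - y) = P x - P y" for x y
    using orthogonal_transformation_linear P Q(1) linear_add linear_diff by blast+
  \<comment> \<open>Translate the inner integral by the preimage of \<open>y\<close>, exchange the integrals, and translate back;
    the ball is invariant under \<open>P\<close>.\<close>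
  have "emeasure lborel ?B * emeasure (distr lborel borel P) X =
      (\<integral>\<^sup>+y. ?b y * (\<integral>\<^sup>+x. ?x (P x) \<partial>lborel) \<partial>lborel)"
  proof -
    have "emeasure (distr lborel borel P) X = (\<integral>\<^sup>+x. ?x (P x) \<partial>lborel)"
      by (subst nn_integral_indicator[symmetric], simp, subst nn_integral_distr) auto
    thus ?thesis by (subst nn_integral_multc) (auto intro: bm)
  qed
  also have "\<dots> = (\<integral>\<^sup>+y. (\<integral>\<^sup>+x. ?b y * ?x (P x + y) \<partial>lborel) \<partial>lborel)"
  proof (intro nn_integral_cong)
    fix y
    have "(\<integral>\<^sup>+x. ?x (P x) \<partial>lborel) = (\<integral>\<^sup>+x. ?x (P (Q y + x)) \<partial>lborel)"
      by (subst nn_integral_lborel_shift) auto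
    thus "?b y * (\<integral>\<^sup>+x. ?x (P x) \<partial>lborel) = (\<integral>\<^sup>+x. ?b y * ?x (P x + y) \<partial>lborel)"
      by (simp add: lin Q add.commute nn_integral_cmult)
  qed
  also have "\<dots> = (\<integral>\<^sup>+x. (\<integral>\<^sup>+y. ?b y * ?x (P x + y) \<partial>lborel) \<partial>lborel)"
    by (rule lborel_pair.Fubini') measurable
  also have "\<dots> = (\<integral>\<^sup>+x. (\<integral>\<^sup>+y. ?b (- P x + y) * ?x y \<partial>lborel) \<partial>lborel)"
  proof (rule nn_integral_cong)
    fix x
    show "(\<integral>\<^sup>+y. ?b y * ?x (P x + y) \<partial>lborel) = (\<integral>\<^sup>+y. ?b (- P x + y) * ?x y \<partial>lborel)"
      using nn_integral_lborel_shift[of "\<lambda>y. ?b (- P x + y) * ?x y" "P x"] by simp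
  qed
  also have "\<dots> = (\<integral>\<^sup>+y. (\<integral>\<^sup>+x. ?b (- P x + y) * ?x y \<partial>lborel) \<partial>lborel)"
    by (rule lborel_pair.Fubini'[symmetric]) measurable
  also have "\<dots> = (\<integral>\<^sup>+y. emeasure lborel ?B * ?x y \<partial>lborel)"
  proof (intro nn_integral_cong)
    fix y
    have "?b (- P x + y) = ?b (- Q y + x)" for x
    proof -
      have "norm (- P x + y) = norm (P (Q y - x))" by (simp add: lin Q)
      also have "\<dots> = norm (- Q y + x)" using orthogonal_transformation_norm[OF P] by (simp add: norm_minus_commute)
      finally show ?thesis by (simp add: indicator_def)
    qed
    hence "(\<integral>\<^sup>+x. ?b (- P x + y) * ?x y \<partial>lborel) = (\<integral>\<^sup>+x. ?b (- Q y + x) * ?x y \<partial>lborel)"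
      by (simp only:)
    also have "\<dots> = (\<integral>\<^sup>+x. ?b (- Q y + x) \<partial>lborel) * ?x y" by (rule nn_integral_multc) measurable
    also have "(\<integral>\<^sup>+x. ?b (- Q y + x) \<partial>lborel) = emeasure lborel ?B"
      by (subst nn_integral_lborel_shift[OF bm]) simp
    finally show "(\<integral>\<^sup>+x. ?b (- P x + y) * ?x y \<partial>lborel) = emeasure lborel ?B * ?x y" .
  qed
  also have "\<dots> = emeasure lborel ?B * emeasure lborel X"
    by (simp add: nn_integral_cmult)
  finally show "emeasure (distr lborel borel P) X = emeasure lborel X"
    using emeasure_lborel_cball_finite[of "0::'a" 1] content_cball_pos[of 1 "0::'a"]
    by (subst (asm) ennreal_mult_cancel_left) (auto simp: measure_def)
qed simp

section \<open>Jensen's inequality on the disk\<close>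

text \<open>
  A discrete form of Jensen's inequality that needs no discussion of zeros: the product of the rotated
  functions \<open>F (z \<omega>\<^sup>k)\<close> over the \<open>N\<close>-th roots of unity is holomorphic, has value \<open>F(0)\<^sup>N\<close> at the
  origin and obeys the maximum principle.
\<close>

lemma roots_of_unity_submean:
  fixes F :: "complex \<Rightarrow> complex" and N :: nat
  assumes hol: "F holomorphic_on ball 0 1" and r: "0 < r" "r < 1"
  obtains \<phi> where "- pi < \<phi>" "\<phi> \<le> pi"
    "norm (F 0) ^ N \<le> (\<Prod>k<N. norm (F (of_real r * cis (\<phi> + of_nat k * (2 * pi / N)))))"
proof -
  define P where "P = (\<lambda>z. \<Prod>k<N. F (z * cis (of_nat k * (2 * pi / N))))"
  have hP: "P holomorphic_on ball 0 1" unfolding P_def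
  proof (intro holomorphic_intros)
    fix k
    have "F \<circ> (\<lambda>z. z * cis (real k * (2 * pi / real N))) holomorphic_on ball 0 1"
      by (rule holomorphic_on_compose_gen[OF _ hol]) (auto intro!: holomorphic_intros simp: norm_mult)
    thus "(\<lambda>z. F (z * cis (real k * (2 * pi / real N)))) holomorphic_on ball 0 1"
      by (simp add: o_def)
  qed
  have sub: "cball 0 r \<subseteq> ball (0::complex) 1" "sphere 0 r \<subseteq> ball (0::complex) 1" using r by auto
  have cP: "continuous_on (cball 0 r) P"
    using hP sub holomorphic_on_imp_continuous_on continuous_on_subset by blast
  have "\<exists>z0\<in>sphere 0 r. \<forall>z\<in>sphere 0 r. norm (P z) \<le> norm (P z0)"
    using r by (intro continuous_attains_sup continuous_on_norm continuous_on_subset[OF cP]) auto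
  then obtain z0 where z0: "norm z0 = r" "\<And>z. norm z = r \<Longrightarrow> norm (P z) \<le> norm (P z0)"
    by (auto simp: sphere_def)
  have "norm (P 0) \<le> norm (P z0)"
  proof (rule maximum_modulus_frontier[where S = "cball 0 r" and f = P])
    show "P holomorphic_on interior (cball 0 r)"
      using hP by (rule holomorphic_on_subset) (use r in auto)
    show "continuous_on (closure (cball 0 r)) P" using cP by simp
    show "norm (P z) \<le> norm (P z0)" if "z \<in> frontier (cball 0 r)" for z
      using that r by (intro z0(2)) (simp add: frontier_cball)
  qed (use r in auto)
  moreover have "z0 = of_real r * cis (Arg z0)"
    using z0(1) rcis_cmod_Arg[of z0] by (simp add: rcis_def)
  hence "P z0 = (\<Prod>k<N. F (of_real r * cis (Arg z0 + of_nat k * (2 * pi / N))))"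
    unfolding P_def cis_mult[symmetric] by (metis (no_types, lifting) mult.assoc)
  moreover have "P 0 = F 0 ^ N" by (simp add: P_def)
  ultimately have "norm (F 0) ^ N \<le> (\<Prod>k<N. norm (F (of_real r * cis (Arg z0 + of_nat k * (2 * pi / N)))))"
    by (simp only: norm_power[symmetric] prod_norm)
  thus ?thesis using that[of "Arg z0"] mpi_less_Arg Arg_le_pi by blast
qed

text \<open>
  After taking logarithms, the previous estimate bounds \<open>ln \<bar>F 0\<bar>\<close> by a Riemann sum of
  \<open>ln (max \<bar>F\<bar> \<delta>)\<close> on the circle of radius \<open>r\<close>, started at an angle \<open>\<phi>\<close> that depends on \<open>N\<close>.
  The cut-off \<open>\<delta>\<close> makes the integrand uniformly continuous, so that the sums converge to the
  integral uniformly in \<open>\<phi>\<close>.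
\<close>

lemma log_submean:
  fixes F :: "complex \<Rightarrow> complex"
  assumes hol: "F holomorphic_on ball 0 1" and r: "0 < r" "r < 1" and \<delta>: "\<delta> > 0" and F0: "F 0 \<noteq> 0"
  shows "2 * pi * ln (norm (F 0)) \<le>
     integral {-pi..pi} (\<lambda>t. ln (max (norm (F (of_real r * cis t))) \<delta>))"
proof -
  define g where "g = (\<lambda>t. ln (max (norm (F (of_real r * cis t))) \<delta>))"
  have cF: "continuous_on UNIV (\<lambda>t. F (of_real r * cis t))"
    by (rule continuous_on_compose2[OF holomorphic_on_imp_continuous_on[OF hol]])
      (use r in \<open>auto intro!: continuous_intros simp: norm_mult\<close>)
  have cg: "continuous_on X g" for X
    unfolding g_def using \<delta>
    by (intro continuous_intros continuous_on_subset[OF cF]) auto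
  have per: "g (t + 2 * pi) = g t" for t by (simp add: g_def flip: cis_mult)
  \<comment> \<open>An antiderivative of \<open>g\<close> on an interval that contains \<open>[-\<pi>, 3 \<pi>]\<close> with room to spare;
    by periodicity its increment over a period does not depend on the starting point.\<close>
  define G where "G = (\<lambda>x. integral {-20..x} g)"
  have dG: "(G has_real_derivative g x) (at x)" if "-20 < x" "x < 20" for x
    using integral_has_real_derivative[OF cg, of x "-20" 20] that
    by (simp add: G_def at_within_Icc_at)
  have pi4: "pi < 4" using pi_less_4 .
  define D where "D = (\<lambda>x. G (x + 2 * pi) - G x)"
  have dD: "(D has_real_derivative 0) (at x)" if "-5 < x" "x < 5" for x
  proof -
    have "((\<lambda>x. G (x + 2 * pi)) has_real_derivative g (x + 2 * pi)) (at x)"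
      using dG[of "x + 2 * pi"] that pi4 pi_gt_zero by (simp add: DERIV_shift)
    from DERIV_diff[OF this dG[of x]] show ?thesis using that by (simp add: D_def per)
  qed
  have Dconst: "D x = D (- pi)" if "-pi < x" "x \<le> pi" for x
  proof (rule DERIV_isconst2[of "-pi" x])
    show "continuous_on {-pi..x} D"
      using that pi4 by (intro continuous_at_imp_continuous_on ballI DERIV_isCont[OF dD]) auto
    show "(D has_real_derivative 0) (at z)" if "-pi < z" "z < x" for z
      using that \<open>x \<le> pi\<close> pi4 by (intro dD) auto
  qed (use that in auto)
  have Dpi: "D (- pi) = integral {-pi..pi} g"
    using Henstock_Kurzweil_Integration.integral_combine[of "-20" "-pi" pi g] pi4 pi_gt_zero
      integrable_continuous_real[OF cg]
    by (simp add: D_def G_def)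
  have "2 * pi * ln (norm (F 0)) \<le> integral {-pi..pi} g + e" if e: "e > 0" for e
  proof -
    define e' where "e' = e / (2 * pi)"
    have e': "e' > 0" using e by (simp add: e'_def)
    have "uniformly_continuous_on {-20..20} g"
      by (intro compact_uniformly_continuous cg) auto
    then obtain d where d: "d > 0" "\<And>x y. x \<in> {-20..20} \<Longrightarrow> y \<in> {-20..20} \<Longrightarrow> \<bar>y - x\<bar> < d \<Longrightarrow> \<bar>g y - g x\<bar> < e'"
      unfolding uniformly_continuous_on_def dist_real_def using e' by metis
    obtain N :: nat where N: "real N > 2 * pi / d" using reals_Archimedean2 by blast
    have N0: "N > 0" using N d(1) pi_gt_zero by (cases N) (auto simp: divide_less_0_iff)
    define h where "h = 2 * pi / N"
    have h: "h > 0" "h < d" "real N * h = 2 * pi"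
      using N N0 d(1) by (auto simp: h_def field_simps)
    obtain \<phi> where \<phi>: "- pi < \<phi>" "\<phi> \<le> pi"
        "norm (F 0) ^ N \<le> (\<Prod>k<N. norm (F (of_real r * cis (\<phi> + of_nat k * h))))"
      using roots_of_unity_submean[OF hol r, of N] unfolding h_def by blast
    define a where "a = (\<lambda>k. \<phi> + of_nat k * h)"
    have a_le: "- pi < a k" "a k \<le> 3 * pi" if "k \<le> N" for k
    proof -
      have "real k * h \<le> 2 * pi" using that h by (metis mult_right_mono of_nat_le_iff less_imp_le)
      moreover have "0 \<le> real k * h" using h by simp
      ultimately show "- pi < a k" "a k \<le> 3 * pi" using \<phi> unfolding a_def by linarith+
    qed
    \<comment> \<open>The mean value theorem compares each term of the Riemann sum with an increment of \<open>G\<close>.\<close>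
    have step: "h * (g (a k) - e') \<le> G (a (Suc k)) - G (a k)" if "k < N" for k
    proof -
      have lt: "a k < a (Suc k)" using h by (simp add: a_def algebra_simps)
      have "\<exists>z>a k. z < a (Suc k) \<and> G (a (Suc k)) - G (a k) = (a (Suc k) - a k) * g z"
        using a_le[of k] a_le[of "Suc k"] that pi4 by (intro MVT2 lt dG) auto
      then obtain z where z: "a k < z" "z < a (Suc k)" "G (a (Suc k)) - G (a k) = (a (Suc k) - a k) * g z" by blast
      have ak: "a (Suc k) - a k = h" by (simp add: a_def algebra_simps)
      have "\<bar>g z - g (a k)\<bar> < e'"
        using z ak h a_le[of k] a_le[of "Suc k"] that pi4 by (intro d(2)) auto
      hence "g (a k) - e' \<le> g z" by linarith
      thus ?thesis using z(3) ak h by (simp add: mult_left_mono)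
    qed
    have "N * ln (norm (F 0)) = ln (norm (F 0) ^ N)" using F0 by (simp add: ln_realpow)
    also have "\<dots> \<le> ln (\<Prod>k<N. exp (g (a k)))"
    proof (rule ln_mono)
      have "(\<Prod>k<N. norm (F (of_real r * cis (\<phi> + of_nat k * h)))) \<le> (\<Prod>k<N. exp (g (a k)))"
        using \<delta> by (intro prod_mono) (simp add: g_def a_def exp_ln less_max_iff_disj)
      thus "norm (F 0) ^ N \<le> (\<Prod>k<N. exp (g (a k)))" using \<phi>(3) by linarith
    qed (use F0 in auto)
    also have "\<dots> = (\<Sum>k<N. g (a k))" by (simp flip: exp_sum)
    finally have "h * (N * ln (norm (F 0))) \<le> h * (\<Sum>k<N. g (a k))"
      using h by (intro mult_left_mono) auto
    hence "2 * pi * ln (norm (F 0)) \<le> (\<Sum>k<N. h * g (a k))"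
    proof -
      have "h * real N = 2 * pi" using h(3) by (simp only: mult.commute)
      hence "h * (N * ln (norm (F 0))) = 2 * pi * ln (norm (F 0))" by (simp only: mult.assoc[symmetric])
      thus ?thesis using \<open>h * (N * ln (norm (F 0))) \<le> _\<close> by (simp only: sum_distrib_left)
    qed
    also have "\<dots> = (\<Sum>k<N. h * (g (a k) - e')) + 2 * pi * e'"
      using h(3) by (simp add: right_diff_distrib sum_subtractf)
    also have "(\<Sum>k<N. h * (g (a k) - e')) \<le> (\<Sum>k<N. G (a (Suc k)) - G (a k))"
      by (intro sum_mono step) auto
    also have "\<dots> = G (a N) - G (a 0)" by (rule sum_lessThan_telescope)
    also have "\<dots> = D \<phi>" using h(3) by (simp add: a_def D_def)
    also have "\<dots> = integral {-pi..pi} g" using Dconst \<phi> Dpi by simp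
    finally show ?thesis by (simp add: e'_def)
  qed
  thus ?thesis unfolding g_def by (rule field_le_epsilon)
qed

section \<open>The logarithmic integral in the half plane\<close>

text \<open>
  The Cayley transform takes the unit circle to the imaginary axis, which is turned into the real axis
  by multiplication with \<open>\<i> y\<close> later on.
\<close>

lemma cayley_cis:
  assumes "- pi < t" "t < pi"
  shows "1 + cis t \<noteq> 0" "(1 - cis t) / (1 + cis t) = - \<i> * of_real (tan (t / 2))"
proof -
  define c s where "c = cos (t / 2)" and "s = sin (t / 2)"
  have c: "c > 0" unfolding c_def using assms by (intro cos_gt_zero_pi) auto
  have cs: "c\<^sup>2 + s\<^sup>2 = 1" by (simp add: c_def s_def)
  have ct: "cis t = (of_real c + \<i> * of_real s)\<^sup>2"
  proof -
    have "cis t = cis (t / 2) * cis (t / 2)" by (simp add: cis_mult)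
    also have "cis (t / 2) = of_real c + \<i> * of_real s" by (simp add: complex_eq_iff c_def s_def)
    finally show ?thesis by (simp add: power2_eq_square)
  qed
  have one: "1 = (of_real (c\<^sup>2 + s\<^sup>2) :: complex)" by (simp only: cs of_real_1)
  have p: "1 + cis t = 2 * of_real c * (of_real c + \<i> * of_real s)"
    unfolding ct by (subst one) (simp add: power2_eq_square algebra_simps)
  have m: "1 - cis t = - 2 * \<i> * of_real s * (of_real c + \<i> * of_real s)"
    unfolding ct by (subst one) (simp add: power2_eq_square algebra_simps)
  have nz: "of_real c + \<i> * of_real s \<noteq> 0" using c by (simp add: complex_eq_iff)
  show "1 + cis t \<noteq> 0" unfolding p using nz c by simp
  show "(1 - cis t) / (1 + cis t) = - \<i> * of_real (tan (t / 2))"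
    unfolding p m using nz c by (simp add: tan_def c_def[symmetric] s_def[symmetric])
qed

lemma cayley_Re_nonneg:
  assumes "norm (\<zeta>::complex) < 1"
  shows "1 + \<zeta> \<noteq> 0" "Re ((1 - \<zeta>) / (1 + \<zeta>)) \<ge> 0"
proof -
  show "1 + \<zeta> \<noteq> 0"
    using assms by (metis add_eq_0_iff norm_minus_cancel norm_one order_less_irrefl)
  have "(Re \<zeta>)\<^sup>2 + (Im \<zeta>)\<^sup>2 < 1"
    using assms by (simp add: cmod_def real_sqrt_less_iff)
  hence "0 \<le> (1 - Re \<zeta>) * (1 + Re \<zeta>) + - Im \<zeta> * Im \<zeta>"
    by (simp add: power2_eq_square algebra_simps)
  thus "Re ((1 - \<zeta>) / (1 + \<zeta>)) \<ge> 0"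
    by (simp add: Re_divide del: minus_mult_commute)
qed

text \<open>
  Jensen's inequality for the pull-back of \<open>H\<close> to the disk by \<open>\<zeta> \<mapsto> \<i> y (1 - \<zeta>) / (1 + \<zeta>)\<close>, which
  sends \<open>0\<close> to \<open>\<i> y\<close> and the boundary point of angle \<open>t\<close> to \<open>y tan (t / 2)\<close>.  The inequality holds on
  circles of radius less than one; since \<open>\<bar>H\<bar> \<le> K\<close> makes all integrands nonnegative, Fatou's lemma
  carries it to the boundary, where continuity can fail only at the angle \<open>\<pi>\<close>.
\<close>

lemma half_plane_log_integral:
  fixes H :: "complex \<Rightarrow> complex"
  assumes hol: "H holomorphic_on UNIV" and bd: "\<And>z. Im z \<ge> 0 \<Longrightarrow> norm (H z) \<le> K"
    and y: "y > 0" and Hy: "H (\<i> * of_real y) \<noteq> 0" and \<delta>: "0 < \<delta>" "\<delta> \<le> K"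
  shows "(\<integral>\<^sup>+t. ennreal (indicator {-pi<..<pi} t * ln (K / max (norm (H (of_real (y * tan (t / 2))))) \<delta>)) \<partial>lborel)
           \<le> ennreal (2 * pi * ln (K / norm (H (\<i> * of_real y))))"
proof -
  define F where "F = (\<lambda>\<zeta>. H (\<i> * of_real y * ((1 - \<zeta>) / (1 + \<zeta>))))"
  have K: "K > 0" using \<delta> by simp
  have Hc: "continuous_on UNIV H" using hol by (rule holomorphic_on_imp_continuous_on)
  have F_hol: "F holomorphic_on ball 0 1"
  proof -
    have "H \<circ> (\<lambda>\<zeta>. \<i> * of_real y * ((1 - \<zeta>) / (1 + \<zeta>))) holomorphic_on ball 0 1"
      by (rule holomorphic_on_compose_gen[OF _ hol]) (auto intro!: holomorphic_intros dest: cayley_Re_nonneg(1))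
    thus ?thesis by (simp add: F_def o_def)
  qed
  have F0: "F 0 = H (\<i> * of_real y)" by (simp add: F_def)
  have F_bd: "norm (F \<zeta>) \<le> K" if "norm \<zeta> < 1" for \<zeta>
  proof -
    have "Im (\<i> * of_real y * w) = y * Re w" for w by simp
    thus ?thesis unfolding F_def using cayley_Re_nonneg(2)[OF that] y
      by (intro bd) (simp only: mult_nonneg_nonneg less_imp_le)
  qed
  define \<Phi> where "\<Phi> = (\<lambda>\<zeta>. ln (K / max (norm (F \<zeta>)) \<delta>))"
  have \<Phi>_nonneg: "\<Phi> \<zeta> \<ge> 0" if "norm \<zeta> < 1" for \<zeta>
    unfolding \<Phi>_def using F_bd[OF that] \<delta> by (intro ln_ge_zero) (simp add: le_divide_eq_1 less_max_iff_disj)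
  \<comment> \<open>Radii of circles exhausting the disk.\<close>
  define r where "r = (\<lambda>n::nat. 1 - 1 / real (n + 2))"
  have r: "0 < r n" "r n < 1" for n by (auto simp: r_def field_simps)
  have r_lim: "r \<longlonglongrightarrow> 1"
  proof -
    have "(\<lambda>n. 1 - 1 / real (n + 2)) \<longlonglongrightarrow> 1 - 0"
      by (intro tendsto_intros LIMSEQ_ignore_initial_segment[OF lim_1_over_n])
    thus ?thesis by (simp add: r_def)
  qed
  let ?B = "2 * pi * ln (K / norm (H (\<i> * of_real y)))"
  let ?u = "\<lambda>n t. ennreal (indicator {-pi..pi} t * \<Phi> (of_real (r n) * cis t))"
  have bound: "(\<integral>\<^sup>+t. ?u n t \<partial>lborel) \<le> ennreal ?B" for n
  proof -
    define f where "f = (\<lambda>t. ln (max (norm (F (of_real (r n) * cis t))) \<delta>))"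
    have cf: "continuous_on {-pi..pi} f" unfolding f_def using \<delta> r[of n]
      by (intro continuous_intros continuous_on_compose2[OF holomorphic_on_imp_continuous_on[OF F_hol]])
         (auto simp: norm_mult less_max_iff_disj)
    have \<Phi>f: "\<Phi> (of_real (r n) * cis t) = ln K - f t" for t
      unfolding \<Phi>_def f_def using K \<delta> by (simp add: ln_div less_max_iff_disj)
    have "((\<lambda>t. ln K - f t) has_integral (2 * pi * ln K - integral {-pi..pi} f)) {-pi..pi}"
    proof (intro has_integral_diff)
      show "((\<lambda>t. ln K) has_integral (2 * pi * ln K)) {-pi..pi}"
        using has_integral_const_real[of "ln K" "-pi" pi] by simp
      show "(f has_integral integral {-pi..pi} f) {-pi..pi}"
        using cf by (intro integrable_integral integrable_continuous_real)
    qed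
    hence "(\<integral>\<^sup>+t. indicator {-pi..pi} t * (ln K - f t) \<partial>lborel) = ennreal (2 * pi * ln K - integral {-pi..pi} f)"
      using \<Phi>_nonneg r[of n] unfolding \<Phi>f[symmetric]
      by (intro nn_integral_has_integral_lebesgue) (auto simp: norm_mult)
    moreover have "2 * pi * ln (norm (F 0)) \<le> integral {-pi..pi} f"
      unfolding f_def using F_hol r \<delta> Hy F0 by (intro log_submean) auto
    moreover have "?B = 2 * pi * ln K - 2 * pi * ln (norm (F 0))"
      using K Hy F0 by (simp add: ln_div right_diff_distrib)
    ultimately show ?thesis unfolding \<Phi>f by (simp add: ennreal_leI)
  qed
  have "(\<integral>\<^sup>+t. ennreal (indicator {-pi<..<pi} t * ln (K / max (norm (H (of_real (y * tan (t / 2))))) \<delta>)) \<partial>lborel)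
        \<le> (\<integral>\<^sup>+t. liminf (\<lambda>n. ?u n t) \<partial>lborel)"
  proof (rule nn_integral_mono)
    fix t
    show "ennreal (indicator {-pi<..<pi} t * ln (K / max (norm (H (of_real (y * tan (t / 2))))) \<delta>))
        \<le> liminf (\<lambda>n. ?u n t)"
    proof (cases "t \<in> {-pi<..<pi}")
      case True
      note ct = cayley_cis[of t]
      have "isCont (\<lambda>\<zeta>. \<i> * of_real y * ((1 - \<zeta>) / (1 + \<zeta>))) (cis t)"
        using True ct(1) by (intro continuous_intros) auto
      moreover have "isCont H z" for z using Hc by (simp add: continuous_on_eq_continuous_at)
      ultimately have "isCont F (cis t)" unfolding F_def by (rule isCont_o2)
      moreover have "(\<lambda>n. of_real (r n) * cis t) \<longlonglongrightarrow> of_real 1 * cis t"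
        by (intro tendsto_intros r_lim)
      ultimately have "(\<lambda>n. F (of_real (r n) * cis t)) \<longlonglongrightarrow> F (cis t)"
        using isCont_tendsto_compose[of "cis t" F] by simp
      hence "(\<lambda>n. \<Phi> (of_real (r n) * cis t)) \<longlonglongrightarrow> \<Phi> (cis t)"
        unfolding \<Phi>_def using \<delta> K by (intro tendsto_intros) (auto simp: max_def)
      hence "(\<lambda>n. ?u n t) \<longlonglongrightarrow> ennreal (\<Phi> (cis t))"
        using True by (simp add: tendsto_ennrealI)
      hence "liminf (\<lambda>n. ?u n t) = ennreal (\<Phi> (cis t))"
        by (intro lim_imp_Liminf) auto
      moreover have "F (cis t) = H (of_real (y * tan (t / 2)))"
      proof -
        have "(1 - cis t) / (1 + cis t) = - \<i> * of_real (tan (t / 2))" using True by (intro ct(2)) auto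
        moreover have "\<i> * of_real y * (- \<i> * of_real (tan (t / 2))) = of_real (y * tan (t / 2))"
          by (simp add: complex_eq_iff)
        ultimately show ?thesis unfolding F_def by (simp only:)
      qed
      ultimately show ?thesis using True by (simp add: \<Phi>_def)
    qed auto
  qed
  also have "\<dots> \<le> liminf (\<lambda>n. \<integral>\<^sup>+t. ?u n t \<partial>lborel)"
  proof (rule nn_integral_liminf)
    fix n
    have "continuous_on {-pi..pi} (\<lambda>t. \<Phi> (of_real (r n) * cis t))"
      unfolding \<Phi>_def using \<delta> K r[of n]
      by (intro continuous_intros continuous_on_compose2[OF holomorphic_on_imp_continuous_on[OF F_hol]])
         (auto simp: norm_mult less_max_iff_disj max_def)
    hence "(\<lambda>t. indicator {-pi..pi} t *\<^sub>R \<Phi> (of_real (r n) * cis t)) \<in> borel_measurable borel"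
      by (intro borel_measurable_continuous_on_indicator) auto
    thus "(\<lambda>t. ?u n t) \<in> borel_measurable lborel" by simp
  qed
  also have "\<dots> \<le> liminf (\<lambda>n::nat. ennreal ?B)"
    by (intro Liminf_mono always_eventually allI bound)
  also have "\<dots> = ennreal ?B" by (simp add: Liminf_const)
  finally show ?thesis .
qed

text \<open>
  The change of variables \<open>r = sqrt (s\<^sup>2 + b\<^sup>2)\<close>, \<open>s = y tan (t / 2)\<close>.  Because \<open>s \<le> r\<close>, the density
  \<open>dr / (1 + r\<^sup>2)\<close> is at most \<open>ds / (1 + s\<^sup>2)\<close>, which in turn is a bounded multiple of \<open>dt\<close>.  The bound
  is uniform in the interval \<open>[t1, t2]\<close>, which avoids the origin and \<open>\<pi>\<close> so that the substitution is
  continuously differentiable even if \<open>b = 0\<close>.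
\<close>

lemma sqrt_tan_substitution:
  fixes M :: "real \<Rightarrow> real" and b y t1 t2 :: real
  assumes M: "continuous_on UNIV M" "\<And>s. M s \<ge> 0" and y: "y > 0" and t: "0 < t1" "t1 \<le> t2" "t2 < pi"
  defines "g \<equiv> \<lambda>t. sqrt ((y * tan (t / 2))\<^sup>2 + b\<^sup>2)"
  shows "(\<integral>\<^sup>+r. ennreal (M (sqrt (r\<^sup>2 - b\<^sup>2)) / (1 + r\<^sup>2) * indicator {g t1..g t2} r) \<partial>lborel)
    \<le> ennreal (y * (1 + 1 / y\<^sup>2) / 2) * (\<integral>\<^sup>+t. ennreal (indicator {-pi<..<pi} t * M (y * tan (t / 2))) \<partial>lborel)"
proof -
  define T where "T = (\<lambda>t::real. tan (t / 2))"
  define g' where "g' = (\<lambda>t. y\<^sup>2 * T t * (1 + (T t)\<^sup>2) / (2 * g t))"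
  have cos0: "cos (t / 2) > 0" and T0: "T t > 0" if "t \<in> {t1..t2}" for t
    using that t by (auto intro!: cos_gt_zero tan_gt_zero simp: T_def)
  have gT: "g t = sqrt ((y * T t)\<^sup>2 + b\<^sup>2)" for t by (simp add: g_def T_def)
  have g_pos: "g t > 0" and g_ge: "y * T t \<le> g t" if "t \<in> {t1..t2}" for t
  proof -
    have "(y * T t)\<^sup>2 + b\<^sup>2 > 0" using T0[OF that] y by (intro add_pos_nonneg) auto
    thus "g t > 0" by (simp add: gT)
    have "sqrt ((y * T t)\<^sup>2) \<le> g t" unfolding gT by (intro real_sqrt_le_mono) simp
    thus "y * T t \<le> g t" using T0[OF that] y by simp
  qed
  have dT: "(T has_real_derivative (1 + (T t)\<^sup>2) / 2) (at t)" if "t \<in> {t1..t2}" for t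
  proof -
    have "((\<lambda>t. tan (t / 2)) has_real_derivative inverse ((cos (t / 2))\<^sup>2) * (1 / 2)) (at t)"
      using cos0[OF that] by (auto intro!: derivative_eq_intros)
    moreover have "inverse ((cos (t / 2))\<^sup>2) = 1 + (T t)\<^sup>2"
      using tan_sec[of "t / 2"] cos0[OF that] by (simp add: T_def power_inverse)
    ultimately show ?thesis by (simp add: T_def[abs_def])
  qed
  have dg: "(g has_real_derivative g' t) (at t)" if "t \<in> {t1..t2}" for t
  proof -
    have pos: "(y * T t)\<^sup>2 + b\<^sup>2 > 0" using g_pos[OF that] by (simp add: gT)
    have "((\<lambda>t. (y * T t)\<^sup>2 + b\<^sup>2) has_real_derivative (y\<^sup>2 * T t * (1 + (T t)\<^sup>2))) (at t)"
      by (rule derivative_eq_intros dT that refl | simp add: power2_eq_square)+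
    from DERIV_real_sqrt[OF pos] this
    have "((\<lambda>t. sqrt ((y * T t)\<^sup>2 + b\<^sup>2)) has_real_derivative
       (inverse (sqrt ((y * T t)\<^sup>2 + b\<^sup>2)) / 2) * (y\<^sup>2 * T t * (1 + (T t)\<^sup>2))) (at t)"
      by (rule DERIV_chain2)
    hence "((\<lambda>t. g t) has_real_derivative (inverse (g t) / 2 * (y\<^sup>2 * T t * (1 + (T t)\<^sup>2)))) (at t)"
      unfolding gT .
    moreover have "inverse v / 2 * w = w / (2 * v)" for v w :: real
      by (simp add: field_simps)
    hence "inverse (g t) / 2 * (y\<^sup>2 * T t * (1 + (T t)\<^sup>2)) = g' t"
      unfolding g'_def .
    ultimately show ?thesis by (simp only:)
  qed
  have cT: "continuous_on {t1..t2} T"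
    using DERIV_isCont[OF dT] by (intro continuous_at_imp_continuous_on ballI)
  have cg: "continuous_on {t1..t2} g"
    using DERIV_isCont[OF dg] by (intro continuous_at_imp_continuous_on ballI)
  have "(\<integral>\<^sup>+r. ennreal (M (sqrt (r\<^sup>2 - b\<^sup>2)) / (1 + r\<^sup>2) * indicator {g t1..g t2} r) \<partial>lborel)
      = (\<integral>\<^sup>+t. ennreal (M (sqrt ((g t)\<^sup>2 - b\<^sup>2)) / (1 + (g t)\<^sup>2) * g' t * indicator {t1..t2} t) \<partial>lborel)"
  proof (rule nn_integral_substitution)
    have "continuous_on UNIV (\<lambda>r. M (sqrt (r\<^sup>2 - b\<^sup>2)) / (1 + r\<^sup>2))"
      by (intro continuous_intros continuous_on_compose2[OF M(1)]) (auto simp: add_nonneg_eq_0_iff)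
    hence "(\<lambda>r. M (sqrt (r\<^sup>2 - b\<^sup>2)) / (1 + r\<^sup>2)) \<in> borel_measurable borel"
      by (rule borel_measurable_continuous_onI)
    thus "set_borel_measurable borel {g t1..g t2} (\<lambda>r. M (sqrt (r\<^sup>2 - b\<^sup>2)) / (1 + r\<^sup>2))"
      unfolding set_borel_measurable_def by measurable
    show "continuous_on {t1..t2} g'" unfolding g'_def
      using g_pos by (intro continuous_intros cT cg) force
    show "g' t \<ge> 0" if "t \<in> {t1..t2}" for t
      unfolding g'_def using g_pos[OF that] T0[OF that] y by (intro divide_nonneg_pos mult_nonneg_nonneg) auto
  qed (use dg t in auto)
  also have "\<dots> \<le> (\<integral>\<^sup>+t. ennreal (y * (1 + 1 / y\<^sup>2) / 2) * ennreal (indicator {-pi<..<pi} t * M (y * tan (t / 2))) \<partial>lborel)"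
  proof (rule nn_integral_mono)
    fix t
    show "ennreal (M (sqrt ((g t)\<^sup>2 - b\<^sup>2)) / (1 + (g t)\<^sup>2) * g' t * indicator {t1..t2} t)
      \<le> ennreal (y * (1 + 1 / y\<^sup>2) / 2) * ennreal (indicator {-pi<..<pi} t * M (y * tan (t / 2)))"
    proof (cases "t \<in> {t1..t2}")
      case True
      define X where "X = y * T t"
      have X: "0 < X" "X \<le> g t" using T0[OF True] g_ge[OF True] y by (auto simp: X_def)
      have gX: "(g t)\<^sup>2 = X\<^sup>2 + b\<^sup>2" by (simp add: gT X_def)
      have s: "sqrt ((g t)\<^sup>2 - b\<^sup>2) = y * tan (t / 2)" using X by (simp add: gX) (simp add: X_def T_def)
      have T2: "(T t)\<^sup>2 = X\<^sup>2 / y\<^sup>2" using y by (simp add: X_def power_mult_distrib)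
      have "g' t / (1 + (g t)\<^sup>2) = (X / g t) * (y * ((1 + X\<^sup>2 / y\<^sup>2) / (1 + (g t)\<^sup>2)) / 2)"
      proof -
        have alg: "y\<^sup>2 * p * q / (2 * G) / v = (y * p / G) * (y * (q / v) / 2)" for p q G v :: real
          by (simp add: power2_eq_square mult_ac)
        show ?thesis unfolding g'_def T2[symmetric] unfolding X_def by (rule alg)
      qed
      also have "\<dots> \<le> 1 * (y * (1 + 1 / y\<^sup>2) / 2)"
      proof (rule mult_mono)
        show "X / g t \<le> 1" using X by (simp add: divide_le_eq_1)
        have "1 + X\<^sup>2 / y\<^sup>2 \<le> (1 + 1 / y\<^sup>2) * (1 + X\<^sup>2)"
        proof -
          have "(1 + c) * (1 + d) = 1 + d * c + (d + c)" for c d :: real by (simp add: algebra_simps)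
          from this[of "1 / y\<^sup>2" "X\<^sup>2"] show ?thesis by simp
        qed
        also have "\<dots> \<le> (1 + 1 / y\<^sup>2) * (1 + (g t)\<^sup>2)"
          unfolding gX by (intro mult_left_mono) (auto simp: add_nonneg_nonneg)
        finally have "(1 + X\<^sup>2 / y\<^sup>2) / (1 + (g t)\<^sup>2) \<le> 1 + 1 / y\<^sup>2"
          by (subst pos_divide_le_eq) (auto intro: add_pos_nonneg)
        thus "y * ((1 + X\<^sup>2 / y\<^sup>2) / (1 + (g t)\<^sup>2)) / 2 \<le> y * (1 + 1 / y\<^sup>2) / 2"
          using y by (intro divide_right_mono mult_left_mono) auto
      qed (use X y in \<open>auto intro!: divide_nonneg_nonneg mult_nonneg_nonneg add_nonneg_nonneg\<close>)
      finally have "g' t / (1 + (g t)\<^sup>2) * M (y * tan (t / 2)) \<le> y * (1 + 1 / y\<^sup>2) / 2 * M (y * tan (t / 2))"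
        using M(2) by (intro mult_right_mono) auto
      moreover have "t \<in> {-pi<..<pi}" using True t by auto
      ultimately show ?thesis using True y M(2) unfolding s
        by (subst ennreal_mult[symmetric]) (auto intro!: ennreal_leI simp: mult_ac)
    qed auto
  qed
  also have "\<dots> = ennreal (y * (1 + 1 / y\<^sup>2) / 2) * (\<integral>\<^sup>+t. ennreal (indicator {-pi<..<pi} t * M (y * tan (t / 2))) \<partial>lborel)"
  proof (rule nn_integral_cmult)
    have "(\<lambda>t. M (y * tan (t / 2))) \<in> borel_measurable borel"
      by (intro measurable_compose[OF _ borel_measurable_continuous_onI[OF M(1)]]) (simp add: tan_def)
    thus "(\<lambda>t. ennreal (indicator {-pi<..<pi} t * M (y * tan (t / 2)))) \<in> borel_measurable lborel"
      by measurable
  qed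
  finally show ?thesis .
qed

text \<open>
  The factor \<open>exp (\<i> a z)\<close> cancels the growth of \<open>H\<close> in the upper half plane without changing its
  modulus on the real line, so a nonzero \<open>H\<close> has a finite Poisson integral of \<open>- ln \<bar>H\<bar>\<close> there, and
  this integral dominates that of \<open>\<rho>\<close>.  The integral of \<open>\<rho>\<close> is a lower integral, which is bounded
  through the measurable majorants \<open>- ln (max \<bar>H\<bar> \<delta>)\<close> up to a constant.
\<close>

lemma exponential_type_vanishes_if_log_integral_diverges:
  fixes H :: "complex \<Rightarrow> complex" and \<rho> :: "real \<Rightarrow> real"
  assumes hol: "H holomorphic_on UNIV"
    and type: "\<And>z. norm (H z) \<le> K * exp (a * \<bar>Im z\<bar>)"
    and b: "b \<ge> 0"
    and decay: "\<And>s::real. norm (H (of_real s)) \<le> C * exp (- \<rho> (sqrt (s\<^sup>2 + b\<^sup>2)))"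
    and diverge: "(\<integral>\<^sup>+r\<in>{b<..}. ennreal (\<rho> r / (1 + r\<^sup>2)) \<partial>lebesgue) = \<infinity>"
  shows "H z = 0"
proof (rule ccontr)
  assume Hz: "H z \<noteq> 0"
  define E where "E = (\<lambda>z. exp (\<i> * of_real a * z) * H z)"
  have holE: "E holomorphic_on UNIV" unfolding E_def using hol by (intro holomorphic_intros)
  \<comment> \<open>A centre for Jensen's inequality: \<open>E\<close> cannot vanish on the whole positive imaginary axis.\<close>
  have "\<exists>y>0. E (\<i> * of_real y) \<noteq> 0"
  proof (rule ccontr)
    assume "\<not> ?thesis"
    hence 0: "E (\<i> * of_real y) = 0" if "y > 0" for y using that by blast
    have "E z = 0"
    proof (rule analytic_continuation[OF holE, where U = "(\<lambda>y. \<i> * of_real y) ` {0<..}" and \<xi> = 0])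
      have "(\<lambda>n. \<i> * of_real (1 / real (Suc n))) \<longlonglongrightarrow> \<i> * of_real 0"
        by (intro tendsto_intros LIMSEQ_Suc lim_1_over_n)
      moreover have "\<i> * of_real (1 / real (Suc n)) \<in> (\<lambda>y. \<i> * of_real y) ` {0<..} - {0}" for n
      proof -
        have "1 / real (Suc n) \<in> {0<..}" unfolding greaterThan_iff by simp
        hence "\<i> * of_real (1 / real (Suc n)) \<in> (\<lambda>y. \<i> * of_real y) ` {0<..}" by (rule imageI)
        moreover have "\<i> * of_real (1 / real (Suc n)) \<noteq> 0"
          unfolding mult_eq_0_iff of_real_eq_0_iff by simp
        ultimately show ?thesis by blast
      qed
      ultimately have "\<i> * of_real 0 islimpt (\<lambda>y. \<i> * of_real y) ` {0<..}"
        unfolding islimpt_sequential by (intro exI[of _ "\<lambda>n. \<i> * of_real (1 / real (Suc n))"]) simp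
      thus "0 islimpt (\<lambda>y. \<i> * of_real y) ` {0<..}" by simp
    qed (use 0 in auto)
    thus False using Hz by (simp add: E_def)
  qed
  then obtain y where y: "y > 0" "E (\<i> * of_real y) \<noteq> 0" by blast
  define K0 where "K0 = max 1 (max K C)"
  have K0: "K0 \<ge> 1" "K \<le> K0" "C \<le> K0" by (auto simp: K0_def)
  have E_bd: "norm (E z) \<le> K0" if "Im z \<ge> 0" for z
  proof -
    have "norm (E z) = exp (- (a * Im z)) * norm (H z)" by (simp add: E_def norm_mult)
    also have "\<dots> \<le> exp (- (a * Im z)) * (K0 * exp (a * Im z))"
      using type[of z] that K0 by (intro mult_left_mono) (auto intro: order.trans mult_right_mono)
    also have "\<dots> = K0" by (simp add: exp_minus)
    finally show ?thesis .
  qed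
  have E_real: "norm (E (of_real s)) = norm (H (of_real s))" for s
    by (simp add: E_def norm_mult)
  \<comment> \<open>The cut-off at height \<open>\<delta> n\<close> and the truncation of the domain to \<open>[t1 n, t2 n]\<close> are removed together
    by Fatou's lemma.  At a zero of \<open>H\<close> the majorants \<open>M n\<close> tend to infinity, so they exceed any value of \<open>\<rho>\<close>.\<close>
  define \<delta> where "\<delta> = (\<lambda>n::nat. K0 / real (Suc n))"
  have \<delta>: "0 < \<delta> n" "\<delta> n \<le> K0" for n using K0 by (auto simp: \<delta>_def field_simps)
  define M where "M = (\<lambda>n s. ln (K0 / max (norm (H (of_real s))) (\<delta> n)))"
  have M_cont: "continuous_on UNIV (M n)" for n
    unfolding M_def using \<delta>[of n] K0
    by (intro continuous_intros continuous_on_compose2[OF holomorphic_on_imp_continuous_on[OF hol]])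
       (auto simp: max_def)
  have M_nonneg: "M n s \<ge> 0" for n s
    unfolding M_def using \<delta>[of n] E_bd[of "of_real s"] E_real[of s] by (intro ln_ge_zero) (simp add: le_divide_eq_1 less_max_iff_disj)
  define t1 t2 where "t1 = (\<lambda>n::nat. pi / real (n + 2))" and "t2 = (\<lambda>n::nat. pi - pi / real (n + 2))"
  have t12: "0 < t1 n" "t1 n \<le> t2 n" "t2 n < pi" for n
    using pi_gt_zero by (auto simp: t1_def t2_def field_simps)
  define g where "g = (\<lambda>t. sqrt ((y * tan (t / 2))\<^sup>2 + b\<^sup>2))"
  define c where "c = y * (1 + 1 / y\<^sup>2) / 2"
  define B where "B = 2 * pi * ln (K0 / norm (E (\<i> * of_real y)))"
  let ?\<phi> = "\<lambda>n r. ennreal (M n (sqrt (r\<^sup>2 - b\<^sup>2)) / (1 + r\<^sup>2) * indicator {g (t1 n)..g (t2 n)} r)"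
  have bound: "(\<integral>\<^sup>+r. ?\<phi> n r \<partial>lborel) \<le> ennreal c * ennreal B" for n
  proof -
    have "(\<integral>\<^sup>+r. ?\<phi> n r \<partial>lborel)
       \<le> ennreal c * (\<integral>\<^sup>+t. ennreal (indicator {-pi<..<pi} t * M n (y * tan (t / 2))) \<partial>lborel)"
      unfolding g_def c_def by (rule sqrt_tan_substitution[OF M_cont M_nonneg y(1) t12])
    also have "(\<integral>\<^sup>+t. ennreal (indicator {-pi<..<pi} t * M n (y * tan (t / 2))) \<partial>lborel) \<le> ennreal B"
      using half_plane_log_integral[OF holE E_bd y \<delta>, of n] unfolding B_def M_def E_real .
    finally show ?thesis by (simp add: mult_left_mono)
  qed
  have \<phi>_meas: "(\<lambda>r. ?\<phi> n r) \<in> borel_measurable borel" for n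
  proof -
    have "continuous_on UNIV (\<lambda>r. M n (sqrt (r\<^sup>2 - b\<^sup>2)) / (1 + r\<^sup>2))"
      by (intro continuous_intros continuous_on_compose2[OF M_cont]) (auto simp: add_nonneg_eq_0_iff)
    hence "(\<lambda>r. M n (sqrt (r\<^sup>2 - b\<^sup>2)) / (1 + r\<^sup>2)) \<in> borel_measurable borel"
      by (rule borel_measurable_continuous_onI)
    thus ?thesis by measurable
  qed
  have pointwise: "ennreal (\<rho> r / (1 + r\<^sup>2)) \<le> liminf (\<lambda>n. ?\<phi> n r)" if r: "r > b" for r
  proof (rule Liminf_bounded)
    define s where "s = sqrt (r\<^sup>2 - b\<^sup>2)"
    have rb: "r\<^sup>2 - b\<^sup>2 > 0" using r b by (simp add: power_strict_mono)
    hence s: "s > 0" "s\<^sup>2 + b\<^sup>2 = r\<^sup>2" by (auto simp: s_def)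
    have sr: "sqrt (s\<^sup>2 + b\<^sup>2) = r" using s r b by simp
    define t where "t = 2 * arctan (s / y)"
    have t: "0 < t" "t < pi" "y * tan (t / 2) = s"
      using s y arctan_ubound[of "s / y"] by (auto simp: t_def zero_less_arctan_iff tan_arctan)
    have e1: "\<forall>\<^sub>F n in sequentially. t1 n < t"
    proof -
      have "(\<lambda>n. pi * (1 / real (n + 2))) \<longlonglongrightarrow> pi * 0"
        by (intro tendsto_intros LIMSEQ_ignore_initial_segment[OF lim_1_over_n])
      thus ?thesis using order_tendstoD(2)[of t1 0 sequentially t] t by (simp add: t1_def)
    qed
    have e2: "\<forall>\<^sub>F n in sequentially. t < t2 n"
    proof -
      have "(\<lambda>n. pi - pi * (1 / real (n + 2))) \<longlonglongrightarrow> pi - pi * 0"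
        by (intro tendsto_intros LIMSEQ_ignore_initial_segment[OF lim_1_over_n])
      thus ?thesis using order_tendstoD(1)[of t2 pi sequentially t] t by (simp add: t2_def)
    qed
    have e3: "\<forall>\<^sub>F n in sequentially. exp (\<rho> r) \<le> real (Suc n)"
      using eventually_ge_at_top[of "nat \<lceil>exp (\<rho> r)\<rceil>"] by eventually_elim linarith
    show "\<forall>\<^sub>F n in sequentially. ennreal (\<rho> r / (1 + r\<^sup>2)) \<le> ?\<phi> n r"
      using e1 e2 e3
    proof eventually_elim
      case (elim n)
      have mono: "g u \<le> g v" if "0 < u" "u \<le> v" "v < pi" for u v
      proof -
        have "tan (u / 2) \<le> tan (v / 2)" using that by (cases "u = v") (auto intro!: less_imp_le tan_monotone)
        moreover have "tan (u / 2) > 0" using that by (intro tan_gt_zero) auto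
        ultimately show ?thesis unfolding g_def using y
          by (intro real_sqrt_le_mono add_right_mono power_mono mult_left_mono) auto
      qed
      have gt: "g t = r" unfolding g_def t(3) by (rule sr)
      have ind: "r \<in> {g (t1 n)..g (t2 n)}"
        using mono[of "t1 n" t] mono[of t "t2 n"] t t12[of n] elim gt by auto
      have "max (norm (H (of_real s))) (\<delta> n) \<le> K0 * exp (- \<rho> r)"
      proof (rule max.boundedI)
        show "norm (H (of_real s)) \<le> K0 * exp (- \<rho> r)"
          using decay[of s] K0(3) unfolding sr by (meson exp_ge_zero mult_right_mono order.trans)
        show "\<delta> n \<le> K0 * exp (- \<rho> r)"
        proof -
          have "inverse (real (Suc n)) \<le> inverse (exp (\<rho> r))" using elim(3) by (rule le_imp_inverse_le) simp
          thus ?thesis using K0 unfolding \<delta>_def exp_minus divide_inverse by (intro mult_left_mono) auto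
        qed
      qed
      hence "ln (max (norm (H (of_real s))) (\<delta> n)) \<le> ln (K0 * exp (- \<rho> r))"
        using \<delta>[of n] by (intro ln_mono) (auto simp: less_max_iff_disj)
      also have "\<dots> = ln K0 - \<rho> r" using K0 by (simp add: ln_mult)
      finally have "\<rho> r \<le> M n s"
        using K0 \<delta>[of n] unfolding M_def by (subst ln_divide_pos) (auto simp: less_max_iff_disj)
      thus ?case using ind unfolding s_def
        by (intro ennreal_leI) (auto intro!: divide_right_mono)
    qed
  qed
  have "(\<integral>\<^sup>+r\<in>{b<..}. ennreal (\<rho> r / (1 + r\<^sup>2)) \<partial>lebesgue) \<le> (\<integral>\<^sup>+r. liminf (\<lambda>n. ?\<phi> n r) \<partial>lebesgue)"
    using pointwise by (intro nn_integral_mono) (auto split: split_indicator)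
  also have "\<dots> = (\<integral>\<^sup>+r. liminf (\<lambda>n. ?\<phi> n r) \<partial>lborel)"
    by (rule nn_integral_completion)
  also have "\<dots> \<le> liminf (\<lambda>n. \<integral>\<^sup>+r. ?\<phi> n r \<partial>lborel)"
    using \<phi>_meas by (intro nn_integral_liminf) simp
  also have "\<dots> \<le> liminf (\<lambda>n::nat. ennreal c * ennreal B)"
    by (intro Liminf_mono always_eventually allI bound)
  also have "\<dots> < \<infinity>" by (simp add: Liminf_const ennreal_mult_less_top)
  finally show False using diverge by simp
qed

section \<open>Complex Gaussian integrals in one variable\<close>

text \<open>
  By Montel's theorem a subsequence converges locally uniformly, and its limit can only be \<open>g\<close>.
\<close>

lemma holomorphic_pointwise_limit:
  fixes h :: "nat \<Rightarrow> complex \<Rightarrow> complex"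
  assumes S: "open S" and hol: "\<And>n. h n holomorphic_on S"
    and bd: "\<And>K. compact K \<Longrightarrow> K \<subseteq> S \<Longrightarrow> \<exists>B. \<forall>n. \<forall>z\<in>K. norm (h n z) \<le> B"
    and lim: "\<And>z. z \<in> S \<Longrightarrow> (\<lambda>n. h n z) \<longlonglongrightarrow> g z"
  shows "g holomorphic_on S"
proof -
  have bd': "\<exists>B. \<forall>f \<in> range h. \<forall>z\<in>K. norm (f z) \<le> B" if "compact K" "K \<subseteq> S" for K
    using bd[OF that] by auto
  have hol': "f holomorphic_on S" if "f \<in> range h" for f
    using that hol by auto
  obtain g' r where g': "g' holomorphic_on S" "strict_mono (r :: nat \<Rightarrow> nat)"
          "\<And>x. x \<in> S \<Longrightarrow> (\<lambda>n. h (r n) x) \<longlonglongrightarrow> g' x"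
  proof (rule Montel[OF S hol' bd' order_refl[of "range h"]])
    fix g r assume "g holomorphic_on S" "strict_mono (r :: nat \<Rightarrow> nat)"
      and *: "\<And>x. x \<in> S \<Longrightarrow> (\<lambda>n. h (r n) x) \<longlonglongrightarrow> g x"
    show thesis by (rule that[of g r]) (fact | erule *)+
  qed
  have "g' z = g z" if "z \<in> S" for z
    using LIMSEQ_subseq_LIMSEQ[OF lim[OF that] g'(2)] g'(3)[OF that]
    by (intro LIMSEQ_unique[of "\<lambda>n. h (r n) z"]) (auto simp: o_def)
  thus ?thesis using g'(1) by (simp cong: holomorphic_cong)
qed

lemma integrable_gaussian_real:
  assumes "(m::real) > 0"
  shows "integrable lborel (\<lambda>x. exp (- m * x\<^sup>2))"
proof -
  have "integrable lborel (\<lambda>x. std_normal_density (sqrt (2*m) * x))"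
    using lborel_integrable_real_affine[OF integrable_normal_moment[of 1 0 0], of "sqrt (2*m)" 0] assms
    by simp
  hence "integrable lborel (\<lambda>x. sqrt (2*pi) * std_normal_density (sqrt (2*m) * x))" by simp
  also have "(\<lambda>x. sqrt (2*pi) * std_normal_density (sqrt (2*m) * x)) = (\<lambda>x. exp (- m * x\<^sup>2))"
    using assms by (auto simp: std_normal_density_def power_mult_distrib)
  finally show ?thesis .
qed

lemma norm_gaussian:
  "norm (exp (- (m::complex) * of_real x ^ 2 + 2 * of_real pi * \<i> * of_real z * of_real x)) = exp (- Re m * x\<^sup>2)"
  by (simp flip: of_real_power)

lemma integrable_gaussian:
  assumes "Re m > 0"
  shows "integrable lborel (\<lambda>x. exp (- (m::complex) * of_real x ^ 2 + 2 * of_real pi * \<i> * of_real z * of_real x))"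
proof (rule Bochner_Integration.integrable_bound[OF integrable_gaussian_real[OF assms]])
  show "(\<lambda>x. exp (- (m::complex) * of_real x ^ 2 + 2 * of_real pi * \<i> * of_real z * of_real x)) \<in> borel_measurable lborel"
    by measurable
  show "AE x in lborel. norm (exp (- m * (complex_of_real x)\<^sup>2 + 2 * complex_of_real pi * \<i> * complex_of_real z * complex_of_real x))
          \<le> norm (exp (- Re m * x\<^sup>2))"
    by (simp only: norm_gaussian) auto
qed

lemma gaussian_fourier_real:
  assumes m: "(m::real) > 0"
  shows "(LINT x|lborel. exp (- of_real m * of_real x ^ 2 + 2 * of_real pi * \<i> * of_real z * of_real x)) =
         of_real (sqrt (pi / m)) * exp (- of_real ((pi * z)\<^sup>2) / of_real m :: complex)"
proof -
  define s where "s = sqrt (2 * m)"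
  have s: "s > 0" "s\<^sup>2 = 2 * m" using m by (auto simp: s_def)
  define t where "t = 2 * pi * z / s"
  have "(LINT x|lborel. exp (- of_real m * of_real x ^ 2 + 2 * of_real pi * \<i> * of_real z * of_real x)) =
        (LINT x|lborel. sqrt (2*pi) *\<^sub>R (std_normal_density (0 + s * x) *\<^sub>R iexp (t * (0 + s * x))))"
  proof (rule Bochner_Integration.integral_cong[OF refl])
    fix x :: real
    have "sqrt (2*pi) * std_normal_density (s * x) = exp (- m * x\<^sup>2)"
      using s by (auto simp: std_normal_density_def power_mult_distrib)
    moreover have "t * (s * x) = 2 * pi * z * x" using s by (auto simp: t_def)
    ultimately have "sqrt (2*pi) *\<^sub>R (std_normal_density (0 + s * x) *\<^sub>R iexp (t * (0 + s * x))) =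
        exp (- m * x\<^sup>2) *\<^sub>R iexp (2 * pi * z * x)"
      by (simp only: scaleR_scaleR add_0)
    also have "\<dots> = exp (- of_real m * of_real x ^ 2 + 2 * of_real pi * \<i> * of_real z * of_real x)"
      unfolding scaleR_conv_of_real exp_of_real[symmetric] exp_add[symmetric] by (simp add: mult_ac)
    finally show "exp (- of_real m * of_real x ^ 2 + 2 * of_real pi * \<i> * of_real z * of_real x) = 
       sqrt (2*pi) *\<^sub>R (std_normal_density (0 + s * x) *\<^sub>R iexp (t * (0 + s * x)))" by (rule sym)
  qed
  also have "\<dots> = sqrt (2*pi) *\<^sub>R (LINT x|lborel. std_normal_density (0 + s * x) *\<^sub>R iexp (t * (0 + s * x)))"
    by (rule integral_scaleR_right)
  also have "(LINT x|lborel. std_normal_density (0 + s * x) *\<^sub>R iexp (t * (0 + s * x))) =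
      (1 / s) *\<^sub>R (LINT x|lborel. std_normal_density x *\<^sub>R iexp (t * x))"
    using lborel_integral_real_affine[of s "\<lambda>x. std_normal_density x *\<^sub>R iexp (t * x)" 0] s by simp
  also have "(LINT x|lborel. std_normal_density x *\<^sub>R iexp (t * x)) = char std_normal_distribution t"
    unfolding char_def by (subst integral_density) auto
  also have "\<dots> = of_real (exp (- (t\<^sup>2) / 2))" by (simp add: char_std_normal_distribution)
  also have "- (t\<^sup>2) / 2 = - (pi * z)\<^sup>2 / m"
    using s m by (simp add: t_def power_divide power_mult_distrib field_simps)
  also have "sqrt (2*pi) *\<^sub>R (1 / s) *\<^sub>R complex_of_real (exp (- (pi * z)\<^sup>2 / m))
     = of_real (sqrt (2*pi) / s) * exp (- of_real ((pi * z)\<^sup>2) / of_real m)"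
    by (simp add: scaleR_conv_of_real flip: exp_of_real)
  also have "sqrt (2*pi) / s = sqrt (pi / m)"
    by (simp add: s_def real_sqrt_divide real_sqrt_mult)
  finally show ?thesis .
qed

text \<open>
  Both sides are holomorphic in \<open>m\<close> on the right half plane and agree for positive \<open>m\<close>, where the
  formula is the characteristic function of the normal distribution.  The left side is holomorphic as a
  locally bounded pointwise limit of integrals over bounded intervals.  On the right side the principal
  logarithm selects the branch of \<open>sqrt (\<pi> / m)\<close>.
\<close>

lemma gaussian_fourier:
  assumes m: "Re m > 0"
  shows "(LINT x|lborel. exp (- (m::complex) * of_real x ^ 2 + 2 * of_real pi * \<i> * of_real z * of_real x)) =
         exp (- Ln (m / of_real pi) / 2) * exp (- of_real ((pi * z)\<^sup>2) / m)"
proof -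
  let ?e = "\<lambda>m x. exp (- (m::complex) * of_real x ^ 2 + 2 * of_real pi * \<i> * of_real z * of_real x)"
  let ?S = "{m. 0 < Re m}"
  define h where "h = (\<lambda>(n::nat) m. integral (cbox (- real n) (real n)) (?e m))"
  define I where "I m = (LINT x|lborel. ?e m x)" for m
  let ?R = "\<lambda>m. exp (- Ln (m / of_real pi) / 2) * exp (- of_real ((pi * z)\<^sup>2) / m)"
  have S: "open ?S" "connected ?S" "convex ?S"
    by (auto simp: open_halfspace_Re_gt convex_halfspace_Re_gt convex_connected)
  have h_eq: "h n m = (LINT x|lborel. indicator {- real n..real n} x *\<^sub>R ?e m x)" for n m
  proof -
    have "set_integrable lborel {- real n..real n} (?e m)"
      by (intro borel_integrable_atLeastAtMost' continuous_intros)
    from set_borel_integral_eq_integral(2)[OF this] show ?thesis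
      by (simp add: h_def set_lebesgue_integral_def)
  qed
  have "I holomorphic_on ?S"
  proof (rule holomorphic_pointwise_limit[where h = h])
    show "h n holomorphic_on ?S" for n
    proof -
      define d where "d = (\<lambda>m x. (- (of_real x)\<^sup>2) * ?e m x)"
      have "(\<lambda>m. integral (cbox (- real n) (real n)) (?e m)) holomorphic_on ?S"
      proof (rule leibniz_rule_holomorphic[where fx = d])
        show "((\<lambda>m. ?e m x) has_field_derivative d m x) (at m within ?S)" for m x
          unfolding d_def by (rule derivative_eq_intros refl | simp)+
        show "?e m integrable_on cbox (- real n) (real n)" for m
          by (intro integrable_continuous continuous_intros)
        show "continuous_on (?S \<times> cbox (- real n) (real n)) (\<lambda>(m, x). d m x)"
          unfolding d_def split_beta by (intro continuous_intros)
      qed (fact S)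
      thus ?thesis by (simp only: h_def)
    qed
    show "(\<lambda>n. h n m) \<longlonglongrightarrow> I m" if "m \<in> ?S" for m unfolding h_eq I_def
    proof (rule integral_dominated_convergence[where w = "\<lambda>x. norm (?e m x)"])
      show "integrable lborel (\<lambda>x. norm (?e m x))"
        using integrable_gaussian that by (intro integrable_norm) auto
      show "AE x in lborel. (\<lambda>n. indicator {- real n..real n} x *\<^sub>R ?e m x) \<longlonglongrightarrow> ?e m x"
      proof (intro AE_I2 tendsto_eventually)
        fix x :: real
        show "\<forall>\<^sub>F n in sequentially. indicator {- real n..real n} x *\<^sub>R ?e m x = ?e m x"
          using eventually_ge_at_top[of "nat \<lceil>\<bar>x\<bar>\<rceil>"]
        proof eventually_elim
          case (elim n)
          hence "x \<in> {- real n..real n}" by auto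
          thus ?case by simp
        qed
      qed
      show "?e m \<in> borel_measurable lborel" by measurable
      show "(\<lambda>x. indicator {- real n..real n} x *\<^sub>R ?e m x) \<in> borel_measurable lborel" for n
        by measurable
      show "AE x in lborel. norm (indicator {- real n..real n} x *\<^sub>R ?e m x) \<le> norm (?e m x)" for n
        by (intro AE_I2) (simp split: split_indicator)
    qed
    show "\<exists>B. \<forall>n. \<forall>m\<in>K. norm (h n m) \<le> B" if K: "compact K" "K \<subseteq> ?S" for K
    proof (cases "K = {}")
      case False
      obtain m0 where m0: "m0 \<in> K" "\<And>m. m \<in> K \<Longrightarrow> Re m0 \<le> Re m"
        using continuous_attains_inf[OF K(1) False continuous_on_Re[OF continuous_on_id]] by blast
      have m0p: "Re m0 > 0" using m0 K by auto
      have "norm (h n m) \<le> (LINT x|lborel. exp (- Re m0 * x\<^sup>2))" if "m \<in> K" for n m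
        unfolding h_eq
      proof (rule Bochner_Integration.integral_norm_bound_integral)
        show "integrable lborel (\<lambda>x. indicator {- real n..real n} x *\<^sub>R ?e m x)"
          using m0(2)[OF that] m0p by (intro integrable_mult_indicator integrable_gaussian) auto
        show "integrable lborel (\<lambda>x. exp (- Re m0 * x\<^sup>2))" using m0p integrable_gaussian_real by blast
        show "norm (indicator {- real n..real n} x *\<^sub>R ?e m x) \<le> exp (- Re m0 * x\<^sup>2)" for x
        proof -
          have "norm (indicator {- real n..real n} x *\<^sub>R ?e m x) \<le> norm (?e m x)"
            by (simp split: split_indicator)
          also have "\<dots> = exp (- Re m * x\<^sup>2)" by (rule norm_gaussian)
          also have "\<dots> \<le> exp (- Re m0 * x\<^sup>2)"
            using mult_right_mono[OF m0(2)[OF that], of "x\<^sup>2"] by simp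
          finally show ?thesis .
        qed
      qed
      thus ?thesis by blast
    qed auto
  qed (fact S)
  moreover have "?R holomorphic_on ?S"
    using pi_gt_zero by (intro holomorphic_intros) (auto simp: complex_nonpos_Reals_iff divide_le_0_iff simp del: pi_gt_zero)
  ultimately have d: "(\<lambda>m. I m - ?R m) holomorphic_on ?S" by (rule holomorphic_on_diff)
  have real0: "I (of_real x) - ?R (of_real x) = 0" if "x > 0" for x
  proof -
    have "exp (- Ln (of_real x / of_real pi) / 2) = complex_of_real (exp (- ln (x / pi) / 2))"
      using that Ln_of_real[of "x/pi"] unfolding exp_of_real[symmetric] by simp
    also have "exp (- ln (x / pi) / 2) = sqrt (pi / x)"
      using that by (simp add: exp_minus ln_sqrt[symmetric] real_sqrt_divide)
    finally show ?thesis using gaussian_fourier_real[OF that] unfolding I_def by simp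
  qed
  have "I m - ?R m = 0"
  proof (rule analytic_continuation[OF d S(1,2), where U = "of_real ` {0<..}" and \<xi> = 1])
    show "(1::complex) islimpt of_real ` {0<..}"
    proof -
      have "(\<lambda>n. complex_of_real (1 + 1 / real (Suc n))) \<longlonglongrightarrow> of_real (1 + 0)"
        by (intro tendsto_intros LIMSEQ_Suc lim_1_over_n)
      moreover have "complex_of_real (1 + 1 / real (Suc n)) \<in> of_real ` {0<..} - {1}" for n
      proof -
        have ne: "1 + 1 / real (Suc n) \<noteq> 1" by simp
        have "1 + 1 / real (Suc n) \<in> {0<..}" unfolding greaterThan_iff by (intro add_pos_pos) auto
        hence "complex_of_real (1 + 1 / real (Suc n)) \<in> of_real ` {0<..}" by (rule imageI)
        thus ?thesis using ne unfolding Diff_iff singleton_iff of_real_eq_1_iff by blast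
      qed
      ultimately have "complex_of_real (1 + 0) islimpt of_real ` {0<..}"
        unfolding islimpt_sequential
        by (intro exI[of _ "\<lambda>n. complex_of_real (1 + 1 / real (Suc n))"]) simp
      thus ?thesis by simp
    qed
  qed (use m real0 in auto)
  thus ?thesis by (simp add: I_def)
qed

section \<open>Gaussians in several variables and Fourier inversion\<close>

lemma product_sigma_finite_lborel: "product_sigma_finite (\<lambda>_. lborel)"
  by standard

text \<open>
  Lebesgue measure on the Euclidean space is the image of a product measure indexed by the
  standard basis; the proof transports the product formula along \<open>i \<mapsto> axis i 1\<close>.
\<close>

lemma
  fixes g :: "'n::finite \<Rightarrow> real \<Rightarrow> 'b::{real_normed_field, banach, second_countable_topology}"
  assumes g: "\<And>i. integrable lborel (g i)"
  shows integrable_prod_vec: "integrable lborel (\<lambda>x::real^'n. \<Prod>i\<in>UNIV. g i (x $ i))"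
    and integral_prod_vec: "(LINT x|(lborel :: (real^'n) measure). (\<Prod>i\<in>UNIV. g i (x $ i))) = (\<Prod>i\<in>UNIV. LINT t|lborel. g i t)"
proof -
  interpret product_sigma_finite "\<lambda>_::real^'n. lborel :: real measure"
    by (rule product_sigma_finite_lborel)
  have B: "Basis = (\<lambda>i. axis i 1 :: real^'n) ` UNIV" by (auto simp: Basis_vec_def)
  have inj: "inj (\<lambda>i. axis i 1 :: real^'n)" by (auto simp: inj_on_def axis_eq_axis)
  have reindex: "(\<Prod>b\<in>Basis. F b) = (\<Prod>i\<in>UNIV. F (axis i 1 :: real^'n))" for F :: "real^'n \<Rightarrow> 'b"
    unfolding B by (simp add: prod.reindex[OF inj] o_def)
  let ?T = "\<lambda>f. \<Sum>b\<in>Basis. f b *\<^sub>R (b :: real^'n)"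
  let ?G = "\<lambda>x::real^'n. \<Prod>i\<in>UNIV. g i (x $ i)"
  have TG: "?G (?T f) = (\<Prod>b\<in>Basis. g (axis_index b) (f b))" for f
  proof -
    have "?T f $ i = f (axis i 1)" for i
      using inner_sum_left_Basis[of "axis i 1" f] by (simp add: inner_axis)
    thus ?thesis by (simp add: reindex axis_index_axis)
  qed
  have meas: "?G \<in> borel_measurable borel"
  proof -
    have "(\<lambda>x::real^'n. g i (x $ i)) \<in> borel_measurable borel" for i
      using borel_measurable_integrable[OF g[of i]] by measurable
    thus ?thesis by measurable
  qed
  have T: "?T \<in> measurable (\<Pi>\<^sub>M b\<in>Basis. lborel) borel" by measurable
  have int: "integrable (\<Pi>\<^sub>M b\<in>(Basis :: (real^'n) set). lborel) (\<lambda>f. \<Prod>b\<in>Basis. g (axis_index b) (f b))"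
    using product_integrable_prod[of Basis "\<lambda>b. g (axis_index b)"] g by simp
  show "integrable lborel ?G"
    unfolding lborel_eq[where 'a = "real^'n"] using int by (subst integrable_distr_eq[OF T meas]) (simp only: TG)
  have "(LINT x|lborel. ?G x) = (LINT f|(\<Pi>\<^sub>M b\<in>(Basis :: (real^'n) set). lborel). (\<Prod>b\<in>Basis. g (axis_index b) (f b)))"
    unfolding lborel_eq[where 'a = "real^'n"] by (subst integral_distr[OF T meas]) (simp only: TG)
  also have "\<dots> = (\<Prod>b\<in>(Basis :: (real^'n) set). LINT t|lborel. g (axis_index b) t)"
    using product_integral_prod[of Basis "\<lambda>b. g (axis_index b)"] g by simp
  also have "\<dots> = (\<Prod>i\<in>UNIV. LINT t|lborel. g i t)"
    by (simp add: reindex axis_index_axis)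
  finally show "(LINT x|lborel. ?G x) = (\<Prod>i\<in>UNIV. LINT t|lborel. g i t)" .
qed

text \<open>
  The multiplication formula \<open>\<integral> \<F>g \<Phi> = \<integral> g \<F>\<Phi>\<close> with a translation built in.  It will be applied to
  the solution and to the initial value with different \<open>\<Phi>\<close>.
\<close>

lemma fourier_multiplication:
  fixes g \<Phi> :: "real^'n \<Rightarrow> complex"
  assumes g: "integrable lborel g" and \<Phi>: "integrable lborel \<Phi>"
  shows "(LINT \<xi>|lborel. fourier g \<xi> * (\<Phi> \<xi> * exp (2 * of_real pi * \<i> * of_real (x \<bullet> \<xi>)))) =
         (LINT y|lborel. g y * (LINT \<xi>|lborel. \<Phi> \<xi> * exp (2 * of_real pi * \<i> * of_real ((x - y) \<bullet> \<xi>))))"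
proof -
  have [measurable]: "g \<in> borel_measurable borel" "\<Phi> \<in> borel_measurable borel"
    using g \<Phi> by (auto dest: borel_measurable_integrable)
  let ?K = "\<lambda>y \<xi>. g y * (\<Phi> \<xi> * exp (2 * of_real pi * \<i> * of_real ((x - y) \<bullet> \<xi>)))"
  have nK: "norm (?K y \<xi>) = norm (g y) * norm (\<Phi> \<xi>)" for y \<xi>
    by (simp add: norm_mult)
  have int: "integrable (lborel \<Otimes>\<^sub>M lborel) (\<lambda>(y, \<xi>). ?K y \<xi>)"
  proof (rule lborel_pair.Fubini_integrable)
    show "(\<lambda>(y, \<xi>). ?K y \<xi>) \<in> borel_measurable (lborel \<Otimes>\<^sub>M lborel)" by measurable
    show "integrable lborel (\<lambda>y. LINT \<xi>|lborel. norm (case (y, \<xi>) of (y, \<xi>) \<Rightarrow> ?K y \<xi>))"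
      using g \<Phi> by (simp only: prod.case nK) simp
    show "AE y in lborel. integrable lborel (\<lambda>\<xi>. case (y, \<xi>) of (y, \<xi>) \<Rightarrow> ?K y \<xi>)"
    proof (intro AE_I2, simp only: prod.case)
      fix y
      have "integrable lborel (\<lambda>\<xi>. norm (g y) * norm (\<Phi> \<xi>))" using \<Phi> by simp
      thus "integrable lborel (\<lambda>\<xi>. ?K y \<xi>)"
        by (rule Bochner_Integration.integrable_bound) (measurable, simp only: nK, simp)
    qed
  qed
  have "(LINT \<xi>|lborel. fourier g \<xi> * (\<Phi> \<xi> * exp (2 * of_real pi * \<i> * of_real (x \<bullet> \<xi>)))) =
        (LINT \<xi>|lborel. (LINT y|lborel. ?K y \<xi>))"
  proof (rule Bochner_Integration.integral_cong[OF refl])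
    fix \<xi>
    have "fourier g \<xi> * (\<Phi> \<xi> * exp (2 * of_real pi * \<i> * of_real (x \<bullet> \<xi>))) =
      (LINT y|lborel. g y * exp (- 2 * of_real pi * \<i> * of_real (y \<bullet> \<xi>)) * (\<Phi> \<xi> * exp (2 * of_real pi * \<i> * of_real (x \<bullet> \<xi>))))"
      unfolding fourier_def by (rule integral_mult_left_zero[symmetric])
    also have "\<dots> = (LINT y|lborel. ?K y \<xi>)"
    proof (rule Bochner_Integration.integral_cong[OF refl])
      fix y
      have "exp (- 2 * of_real pi * \<i> * of_real (y \<bullet> \<xi>)) * exp (2 * of_real pi * \<i> * of_real (x \<bullet> \<xi>)) =
          exp (2 * of_real pi * \<i> * of_real ((x - y) \<bullet> \<xi>))"
        unfolding exp_add[symmetric] by (simp add: inner_diff_left algebra_simps)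
      thus "g y * exp (- 2 * of_real pi * \<i> * of_real (y \<bullet> \<xi>)) * (\<Phi> \<xi> * exp (2 * of_real pi * \<i> * of_real (x \<bullet> \<xi>))) = ?K y \<xi>"
        by (simp only: mult_ac)
    qed
    finally show "fourier g \<xi> * (\<Phi> \<xi> * exp (2 * of_real pi * \<i> * of_real (x \<bullet> \<xi>))) = (LINT y|lborel. ?K y \<xi>)" .
  qed
  also have "\<dots> = (LINT y|lborel. (LINT \<xi>|lborel. ?K y \<xi>))"
    by (rule lborel_pair.Fubini_integral[OF int])
  also have "\<dots> = (LINT y|lborel. g y * (LINT \<xi>|lborel. \<Phi> \<xi> * exp (2 * of_real pi * \<i> * of_real ((x - y) \<bullet> \<xi>))))"
    by simp
  finally show ?thesis .
qed

definition gaussian :: "('n::finite \<Rightarrow> complex) \<Rightarrow> real^'n \<Rightarrow> complex" where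
  "gaussian m \<xi> = exp (- (\<Sum>i\<in>UNIV. m i * of_real (\<xi> $ i) ^ 2))"

text \<open>
  The Fourier transform of \<open>exp (- m \<xi>\<^sup>2)\<close>, that is \<open>sqrt (\<pi> / m) exp (- \<pi>\<^sup>2 z\<^sup>2 / m)\<close> with the principal
  root.
\<close>

definition gaussian_kernel :: "complex \<Rightarrow> real \<Rightarrow> complex" where
  "gaussian_kernel m z = exp (- Ln (m / of_real pi) / 2) * exp (- of_real ((pi * z)\<^sup>2) / m)"

lemma gaussian_times_character:
  "gaussian m \<xi> * exp (2 * of_real pi * \<i> * of_real (z \<bullet> \<xi>)) =
   (\<Prod>i\<in>UNIV. exp (- m i * of_real (\<xi> $ i) ^ 2 + 2 * of_real pi * \<i> * of_real (z $ i) * of_real (\<xi> $ i)))"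
  unfolding gaussian_def exp_add[symmetric] exp_sum[OF finite, symmetric]
  by (simp add: inner_vec_def sum.distrib sum_negf sum_subtractf sum_distrib_left mult.assoc)

lemma integrable_gaussian_vec:
  assumes "\<And>i. Re (m i) > 0"
  shows "integrable lborel (gaussian m :: real^'n \<Rightarrow> complex)"
proof -
  have "gaussian m = (\<lambda>\<xi>::real^'n. \<Prod>i\<in>UNIV. exp (- m i * of_real (\<xi> $ i) ^ 2 + 2 * of_real pi * \<i> * of_real 0 * of_real (\<xi> $ i)))"
    using gaussian_times_character[of m _ 0] by (intro ext) simp
  thus ?thesis
    using integrable_prod_vec[of "\<lambda>i t. exp (- m i * of_real t ^ 2 + 2 * of_real pi * \<i> * of_real 0 * of_real t)",
      OF integrable_gaussian[OF assms]] by (simp only:)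
qed

lemma fourier_gaussian_vec:
  assumes "\<And>i. Re (m i) > 0"
  shows "(LINT \<xi>|(lborel :: (real^'n) measure). gaussian m \<xi> * exp (2 * of_real pi * \<i> * of_real (z \<bullet> \<xi>))) =
    (\<Prod>i\<in>UNIV. gaussian_kernel (m i) (z $ i))"
  unfolding gaussian_times_character gaussian_kernel_def
  using integral_prod_vec[of "\<lambda>i t. exp (- m i * of_real t ^ 2 + 2 * of_real pi * \<i> * of_real (z $ i) * of_real t)",
      OF integrable_gaussian[OF assms]]
  by (simp only: gaussian_fourier[OF assms])

lemma gaussian_kernel_real:
  assumes "\<delta> > 0"
  shows "gaussian_kernel (of_real (pi * \<delta>\<^sup>2)) z = of_real (exp (- pi * (z / \<delta>)\<^sup>2) / \<delta>)"
proof -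
  have "ln (\<delta>\<^sup>2) = 2 * ln \<delta>" using assms by (simp add: ln_realpow)
  hence "exp (- Ln (of_real (pi * \<delta>\<^sup>2) / of_real pi) / 2) = complex_of_real (exp (- ln \<delta>))"
    using assms Ln_of_real[of "\<delta>\<^sup>2"] unfolding exp_of_real[symmetric] by simp
  also have "exp (- ln \<delta>) = 1 / \<delta>" using assms by (simp add: exp_minus divide_inverse)
  finally have 1: "exp (- Ln (of_real (pi * \<delta>\<^sup>2) / of_real pi) / 2) = complex_of_real (1 / \<delta>)" .
  have "- (pi * z)\<^sup>2 / (pi * \<delta>\<^sup>2) = - pi * (z / \<delta>)\<^sup>2"
    using assms by (simp add: power2_eq_square field_simps)
  hence "- of_real ((pi * z)\<^sup>2) / of_real (pi * \<delta>\<^sup>2) = complex_of_real (- pi * (z / \<delta>)\<^sup>2)"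
    by (metis of_real_divide of_real_minus)
  thus ?thesis unfolding gaussian_kernel_def 1 by (simp flip: exp_of_real)
qed

text \<open>
  The parameter is chosen so that \<open>mollifier \<delta>\<close> is \<open>mollifier 1\<close> rescaled by \<open>\<delta>\<close>; in terms of
  \<open>gaussian_kernel\<close> it belongs to \<open>m = \<pi> \<delta>\<^sup>2\<close>.
\<close>

definition mollifier :: "real \<Rightarrow> real^'n::finite \<Rightarrow> real" where
  "mollifier \<delta> z = exp (- pi * (norm z / \<delta>)\<^sup>2) / \<delta> ^ CARD('n)"

lemma prod_gaussian_kernel_real:
  assumes "\<delta> > 0"
  shows "(\<Prod>i\<in>UNIV. gaussian_kernel (of_real (pi * \<delta>\<^sup>2)) (z $ i)) = of_real (mollifier \<delta> (z :: real^'n))"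
proof -
  have "(\<Prod>i\<in>UNIV. exp (- pi * (z $ i / \<delta>)\<^sup>2) / \<delta>) = exp (\<Sum>i\<in>UNIV. - pi * (z $ i / \<delta>)\<^sup>2) / \<delta> ^ CARD('n)"
    by (simp add: prod_dividef exp_sum)
  also have "(\<Sum>i\<in>UNIV. - pi * (z $ i / \<delta>)\<^sup>2) = - pi * (norm z / \<delta>)\<^sup>2"
  proof -
    have "(norm z)\<^sup>2 = (\<Sum>i\<in>UNIV. (z $ i)\<^sup>2)"
      unfolding power2_norm_eq_inner inner_vec_def by (simp add: power2_eq_square)
    thus ?thesis by (simp add: power_divide sum_distrib_left sum_negf flip: sum_divide_distrib)
  qed
  finally show ?thesis
    unfolding gaussian_kernel_real[OF assms] mollifier_def by (simp only: of_real_prod[symmetric])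
qed

lemma
  shows integrable_mollifier_1: "integrable lborel (mollifier 1 :: real^'n \<Rightarrow> real)"
    and integral_mollifier_1: "(LINT z|lborel. mollifier 1 (z :: real^'n)) = 1"
proof -
  have int: "integrable lborel (\<lambda>t. exp (- pi * t\<^sup>2))" by (rule integrable_gaussian_real) simp
  have "complex_of_real (LINT t|lborel. exp (- pi * t\<^sup>2)) = (LINT t|lborel. complex_of_real (exp (- pi * t\<^sup>2)))"
    by (rule integral_complex_of_real[symmetric])
  also have "\<dots> = 1" using gaussian_fourier_real[of pi 0] by (simp flip: exp_of_real)
  finally have one: "(LINT t|lborel. exp (- pi * t\<^sup>2)) = 1" by (simp only: of_real_eq_1_iff)
  have m: "mollifier 1 = (\<lambda>z::real^'n. \<Prod>i\<in>UNIV. exp (- pi * (z $ i)\<^sup>2))"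
  proof
    fix z :: "real^'n"
    have "(norm z)\<^sup>2 = (\<Sum>i\<in>UNIV. (z $ i)\<^sup>2)"
      unfolding power2_norm_eq_inner inner_vec_def by (simp add: power2_eq_square)
    thus "mollifier 1 z = (\<Prod>i\<in>UNIV. exp (- pi * (z $ i)\<^sup>2))"
      by (simp add: mollifier_def sum_distrib_left sum_negf flip: exp_sum)
  qed
  show "integrable lborel (mollifier 1 :: real^'n \<Rightarrow> real)"
    unfolding m using int by (rule integrable_prod_vec)
  show "(LINT z|lborel. mollifier 1 (z :: real^'n)) = 1"
    unfolding m using integral_prod_vec[of "\<lambda>_ t. exp (- pi * t\<^sup>2)", OF int] one by simp
qed

lemma mollifier_measurable [measurable]: "mollifier \<delta> \<in> borel_measurable borel"
  unfolding mollifier_def by measurable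

lemma integral_lborel_affine:
  fixes F :: "'a::euclidean_space \<Rightarrow> 'b::{banach, second_countable_topology}"
  assumes [measurable]: "F \<in> borel_measurable borel" and "c \<noteq> 0"
  shows "(LINT y|lborel. F y) = (LINT z|lborel. \<bar>c\<bar> ^ DIM('a) *\<^sub>R F (t + c *\<^sub>R z))"
  by (subst lborel_affine[OF \<open>c \<noteq> 0\<close>, of t], subst integral_density) (auto simp: integral_distr)

lemma mollified_near:
  fixes v :: "real^'n \<Rightarrow> complex"
  assumes [measurable]: "v \<in> borel_measurable borel" and bd: "\<And>y. norm (v y) \<le> B" and cont: "isCont v x"
    and \<delta>: "\<And>k. \<delta> k > 0" "\<delta> \<longlonglongrightarrow> 0"
  shows "(\<lambda>k. LINT y|lborel. v y * of_real (mollifier (\<delta> k) (x - y))) \<longlonglongrightarrow> v x"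
proof -
  have eq: "(LINT y|lborel. v y * of_real (mollifier (\<delta> k) (x - y))) =
        (LINT z|lborel. v (x + \<delta> k *\<^sub>R z) * of_real (mollifier 1 z))" for k
  proof -
    have "(LINT y|lborel. v y * of_real (mollifier (\<delta> k) (x - y))) =
       (LINT z|lborel. \<bar>\<delta> k\<bar> ^ DIM(real^'n) *\<^sub>R (v (x + \<delta> k *\<^sub>R z) * of_real (mollifier (\<delta> k) (x - (x + \<delta> k *\<^sub>R z)))))"
      using \<delta>(1)[of k] by (intro integral_lborel_affine) auto
    also have "\<dots> = (LINT z|lborel. v (x + \<delta> k *\<^sub>R z) * of_real (mollifier 1 z))"
    proof (rule Bochner_Integration.integral_cong[OF refl])
      fix z :: "real^'n"
      have "\<bar>\<delta> k\<bar> ^ DIM(real^'n) * mollifier (\<delta> k) (x - (x + \<delta> k *\<^sub>R z)) = mollifier 1 z"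
        using \<delta>(1)[of k] by (simp add: mollifier_def)
      thus "\<bar>\<delta> k\<bar> ^ DIM(real^'n) *\<^sub>R (v (x + \<delta> k *\<^sub>R z) * of_real (mollifier (\<delta> k) (x - (x + \<delta> k *\<^sub>R z))))
          = v (x + \<delta> k *\<^sub>R z) * of_real (mollifier 1 z)"
        by (metis (no_types, lifting) mult.left_commute of_real_mult scaleR_conv_of_real)
    qed
    finally show ?thesis .
  qed
  have "(\<lambda>k. LINT z|lborel. v (x + \<delta> k *\<^sub>R z) * of_real (mollifier 1 z)) \<longlonglongrightarrow> (LINT z|lborel. v x * of_real (mollifier 1 (z :: real^'n)))"
  proof (rule integral_dominated_convergence[where w = "\<lambda>z. B * mollifier 1 z"])
    show "integrable lborel (\<lambda>z::real^'n. B * mollifier 1 z)" using integrable_mollifier_1[where 'n = 'n] by simp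
    show "AE z in lborel. (\<lambda>k. v (x + \<delta> k *\<^sub>R z) * of_real (mollifier 1 z)) \<longlonglongrightarrow> v x * of_real (mollifier 1 z)"
    proof (intro AE_I2 tendsto_mult tendsto_const)
      fix z
      have "(\<lambda>k. x + \<delta> k *\<^sub>R z) \<longlonglongrightarrow> x + 0 *\<^sub>R z" by (intro tendsto_intros \<delta>)
      thus "(\<lambda>k. v (x + \<delta> k *\<^sub>R z)) \<longlonglongrightarrow> v x"
        using isCont_tendsto_compose[OF cont] by simp
    qed
    show "AE z in lborel. norm (v (x + \<delta> k *\<^sub>R z) * of_real (mollifier 1 z)) \<le> B * mollifier 1 z" for k
      using bd by (intro AE_I2) (auto simp: norm_mult mollifier_def intro!: mult_right_mono)
  qed measurable
  moreover have "(LINT z|lborel. v x * of_real (mollifier 1 (z :: real^'n))) = v x"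
    using integral_mollifier_1[where 'n = 'n] integral_complex_of_real[of lborel "mollifier 1 :: real^'n \<Rightarrow> real"] by simp
  ultimately show ?thesis unfolding eq by (simp only:)
qed

lemma mollified_far:
  fixes v :: "real^'n \<Rightarrow> complex"
  assumes v: "integrable lborel v" and zero: "\<And>y. dist x y < 1 \<Longrightarrow> v y = 0"
  shows "(\<lambda>k. LINT y|lborel. v y * of_real (mollifier (1 / real (Suc k)) (x - y))) \<longlonglongrightarrow> 0"
proof (rule tendsto_norm_zero_cancel, rule tendsto_sandwich[OF _ _ tendsto_const])
  have [measurable]: "v \<in> borel_measurable borel" using v by (auto dest: borel_measurable_integrable)
  define I where "I = (LINT y|lborel. norm (v y))"
  define q where "q = (\<lambda>k. real (Suc k) ^ CARD('n) / exp (real (Suc k)))"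
  have "norm (LINT y|lborel. v y * of_real (mollifier (1 / real (Suc k)) (x - y))) \<le> (LINT y|lborel. norm (v y) * q k)" for k
  proof -
    \<comment> \<open>With \<open>N = Suc k\<close> and \<open>\<bar>x - y\<bar> \<ge> 1\<close> the Gaussian factor is at most \<open>exp (- \<pi> N\<^sup>2) \<le> exp (- N)\<close>, which
      beats the normalization \<open>N\<^sup>n\<close>.\<close>
    have pw: "norm (v y * of_real (mollifier (1 / real (Suc k)) (x - y))) \<le> norm (v y) * q k" for y
    proof (cases "dist x y < 1")
      case False
      define N where "N = real (Suc k)"
      have N: "N \<ge> 1" by (simp add: N_def)
      have d: "norm (x - y) \<ge> 1" using False by (simp add: dist_norm)
      have "1 * N \<le> norm (x - y) * N" using d N by (intro mult_right_mono) auto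
      hence "N * 1 \<le> (norm (x - y) * N) * (norm (x - y) * N)"
        using N by (intro mult_mono) linarith+
      hence "N \<le> (norm (x - y) * N)\<^sup>2" by (simp add: power2_eq_square)
      moreover have "1 * (norm (x - y) * N)\<^sup>2 \<le> pi * (norm (x - y) * N)\<^sup>2"
        using pi_gt3 by (intro mult_right_mono) auto
      ultimately have "exp (- pi * (norm (x - y) * N)\<^sup>2) \<le> exp (- N)" by simp
      hence "mollifier (1 / N) (x - y) \<le> exp (- N) * N ^ CARD('n)"
        using N unfolding mollifier_def by (simp add: power_divide mult_right_mono)
      hence "mollifier (1 / real (Suc k)) (x - y) \<le> q k"
        unfolding q_def N_def exp_minus divide_inverse by (simp only: mult.commute)
      moreover have "mollifier (1 / real (Suc k)) (x - y) \<ge> 0" by (simp add: mollifier_def)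
      ultimately show ?thesis by (simp add: norm_mult mult_left_mono del: of_nat_Suc)
    qed (use zero in \<open>auto simp: q_def\<close>)
    have int: "integrable lborel (\<lambda>y. norm (v y) * q k)" using v by simp
    moreover have "integrable lborel (\<lambda>y. v y * of_real (mollifier (1 / real (Suc k)) (x - y)))"
      by (rule Bochner_Integration.integrable_bound[OF int]) (measurable, use pw order_trans[OF pw abs_ge_self] in auto)
    ultimately show ?thesis
      using pw by (intro Bochner_Integration.integral_norm_bound_integral) auto
  qed
  thus "\<forall>\<^sub>F k in sequentially. norm (LINT y|lborel. v y * of_real (mollifier (1 / real (Suc k)) (x - y))) \<le> I * q k"
    by (simp add: I_def)
  have "((\<lambda>t::real. t ^ CARD('n) / exp t) \<longlongrightarrow> 0) at_top" by (rule tendsto_power_div_exp_0)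
  hence "(\<lambda>k. real k ^ CARD('n) / exp (real k)) \<longlonglongrightarrow> 0"
    by (rule filterlim_compose[OF _ filterlim_real_sequentially])
  hence "q \<longlonglongrightarrow> 0" unfolding q_def by (rule LIMSEQ_Suc)
  thus "(\<lambda>k. I * q k) \<longlonglongrightarrow> 0" by (rule tendsto_mult_right_zero)
qed auto

text \<open>
  As \<open>u\<close> need not be bounded, it is split at the unit sphere around \<open>x\<close>: the inner part is bounded and
  continuous at \<open>x\<close>, and on the outer part the mollifier tends to zero uniformly.
\<close>

lemma mollified_limit:
  fixes u :: "real^'n \<Rightarrow> complex"
  assumes cont: "continuous_on UNIV u" and u: "integrable lborel u"
  shows "(\<lambda>k. LINT y|lborel. u y * of_real (mollifier (1 / real (Suc k)) (x - y))) \<longlonglongrightarrow> u x"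
proof -
  have u_meas: "u \<in> borel_measurable borel" using u by (auto dest: borel_measurable_integrable)
  define v where "v = (\<lambda>y. indicator (ball x 1) y *\<^sub>R u y)"
  define w where "w = (\<lambda>y. indicator (- ball x 1) y *\<^sub>R u y)"
  have vw: "u y = v y + w y" for y by (simp add: v_def w_def split: split_indicator)
  have [measurable]: "v \<in> borel_measurable borel" "w \<in> borel_measurable borel"
    unfolding v_def w_def by (intro borel_measurable_scaleR borel_measurable_indicator u_meas; simp)+
  have "compact (u ` cball x 1)"
    by (intro compact_continuous_image continuous_on_subset[OF cont]) auto
  then obtain B where B: "\<And>y. y \<in> cball x 1 \<Longrightarrow> norm (u y) \<le> B" "B > 0"
    using compact_imp_bounded bounded_pos by (metis imageI)
  have v_bd: "norm (v y) \<le> B" for y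
    using B(1)[of y] B(2) by (auto simp: v_def split: split_indicator)
  have w_int: "integrable lborel w" unfolding w_def using u by (intro integrable_mult_indicator) auto
  have v_int: "integrable lborel v" unfolding v_def using u by (intro integrable_mult_indicator) auto
  have v_cont: "isCont v x"
  proof -
    have "\<forall>\<^sub>F y in nhds x. v y = u y"
      using eventually_nhds_in_open[of "ball x 1" x] by (auto elim!: eventually_mono simp: v_def)
    thus ?thesis using cont by (simp add: isCont_cong continuous_on_eq_continuous_at)
  qed
  have lim0: "(\<lambda>k. 1 / real (Suc k)) \<longlonglongrightarrow> 0" by (rule LIMSEQ_Suc[OF lim_1_over_n])
  have "(\<lambda>k. LINT y|lborel. v y * of_real (mollifier (1 / real (Suc k)) (x - y))) \<longlonglongrightarrow> v x"
    using v_bd v_cont lim0 by (intro mollified_near) auto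
  moreover have "(\<lambda>k. LINT y|lborel. w y * of_real (mollifier (1 / real (Suc k)) (x - y))) \<longlonglongrightarrow> 0"
    using w_int by (intro mollified_far) (auto simp: w_def)
  ultimately have "(\<lambda>k. (LINT y|lborel. v y * of_real (mollifier (1 / real (Suc k)) (x - y))) +
      (LINT y|lborel. w y * of_real (mollifier (1 / real (Suc k)) (x - y)))) \<longlonglongrightarrow> v x + 0"
    by (rule tendsto_add)
  moreover have "(LINT y|lborel. v y * of_real (mollifier (1 / real (Suc k)) (x - y))) +
      (LINT y|lborel. w y * of_real (mollifier (1 / real (Suc k)) (x - y))) =
      (LINT y|lborel. u y * of_real (mollifier (1 / real (Suc k)) (x - y)))" for k
  proof -
    define c where "c = real (Suc k) ^ CARD('n)"
    have m_le: "norm (mollifier (1 / real (Suc k)) z) \<le> c" for z :: "real^'n"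
      by (simp add: mollifier_def power_divide c_def mult_left_le_one_le del: of_nat_Suc)
    have int: "integrable lborel (\<lambda>y. f y * of_real (mollifier (1 / real (Suc k)) (x - y)))"
      if f: "integrable lborel f" for f :: "real^'n \<Rightarrow> complex"
    proof (rule Bochner_Integration.integrable_bound)
      show "integrable lborel (\<lambda>y. norm (f y) * c)" using f by simp
      have [measurable]: "f \<in> borel_measurable borel" using f by (auto dest: borel_measurable_integrable)
      show "(\<lambda>y. f y * of_real (mollifier (1 / real (Suc k)) (x - y))) \<in> borel_measurable lborel" by measurable
      have "norm (f y * of_real (mollifier (1 / real (Suc k)) (x - y))) \<le> norm (norm (f y) * c)" for y
        using m_le[of "x - y"] abs_ge_self[of "norm (f y) * c"]
        unfolding norm_mult norm_of_real real_norm_def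
        by (meson mult_left_mono norm_ge_zero order_trans abs_ge_zero)
      thus "AE y in lborel. norm (f y * of_real (mollifier (1 / real (Suc k)) (x - y))) \<le> norm (norm (f y) * c)"
        by blast
    qed
    show ?thesis
      unfolding vw distrib_right by (rule Bochner_Integration.integral_add[symmetric]) (intro int v_int w_int)+
  qed
  ultimately show ?thesis by (simp add: v_def)
qed

text \<open>
  The multiplication formula turns the Gaussian means of the inversion integral into convolutions of
  \<open>u\<close> with the mollifier.
\<close>

lemma fourier_gaussian_inversion:
  fixes u :: "real^'n \<Rightarrow> complex"
  assumes cont: "continuous_on UNIV u" and u: "integrable lborel u"
  shows "(\<lambda>k. LINT \<xi>|lborel. fourier u \<xi> * (gaussian (\<lambda>_. of_real (pi * (1 / real (Suc k))\<^sup>2)) \<xi> *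
            exp (2 * of_real pi * \<i> * of_real (x \<bullet> \<xi>)))) \<longlonglongrightarrow> u x"
proof -
  have "(LINT \<xi>|lborel. fourier u \<xi> * (gaussian (\<lambda>_. of_real (pi * (1 / real (Suc k))\<^sup>2)) \<xi> *
            exp (2 * of_real pi * \<i> * of_real (x \<bullet> \<xi>)))) =
        (LINT y|lborel. u y * of_real (mollifier (1 / real (Suc k)) (x - y)))" for k
  proof -
    have pos: "Re (of_real (pi * (1 / real (Suc k))\<^sup>2)) > 0" by simp
    have "1 / real (Suc k) > 0" by simp
    note kernel = prod_gaussian_kernel_real[OF this]
    show ?thesis
      unfolding fourier_multiplication[OF u integrable_gaussian_vec[OF pos]] fourier_gaussian_vec[OF pos]
      by (simp only: kernel)
  qed
  thus ?thesis using mollified_limit[OF cont u, of x] by (simp only:)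
qed

lemma fourier_zero_imp_zero:
  fixes u :: "real^'n \<Rightarrow> complex"
  assumes "continuous_on UNIV u" "integrable lborel u" "\<And>\<xi>. fourier u \<xi> = 0"
  shows "u x = 0"
  using fourier_gaussian_inversion[OF assms(1,2), of x] assms(3)
  by (simp add: LIMSEQ_const_iff)

section \<open>Analytic extension of the solution along lines\<close>

lemma Re_of_real_mult: "Re (of_real a * z) = a * Re z"
  and Im_of_real_mult: "Im (of_real a * z) = a * Im z"
  by simp_all

lemma norm_gaussian_kernel_le:
  assumes "\<epsilon> > 0" "\<tau> \<noteq> 0"
  shows "norm (gaussian_kernel (Complex \<epsilon> \<tau>) t) \<le> sqrt (pi / \<bar>\<tau>\<bar>)"
proof -
  let ?m = "Complex \<epsilon> \<tau>"
  have nz: "?m \<noteq> 0" using assms by (simp add: complex_eq_iff)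
  have "\<bar>\<tau>\<bar> \<le> norm ?m" using abs_Im_le_cmod[of ?m] by simp
  have "norm (exp (- Ln (?m / of_real pi) / 2)) = exp (- ln (norm ?m / pi) / 2)"
    using nz by (simp add: norm_divide)
  also have "\<dots> = sqrt (pi / norm ?m)"
    using nz by (simp add: exp_minus ln_sqrt[symmetric] real_sqrt_divide)
  also have "\<dots> \<le> sqrt (pi / \<bar>\<tau>\<bar>)"
    using \<open>\<bar>\<tau>\<bar> \<le> norm ?m\<close> assms nz by (intro real_sqrt_le_mono divide_left_mono mult_pos_pos) auto
  finally have 1: "norm (exp (- Ln (?m / of_real pi) / 2)) \<le> sqrt (pi / \<bar>\<tau>\<bar>)" .
  have "Re (of_real ((pi * t)\<^sup>2) / ?m) \<ge> 0"
    using assms by (simp add: Re_divide divide_nonneg_nonneg)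
  hence "norm (exp (- of_real ((pi * t)\<^sup>2) / ?m)) \<le> 1" by simp
  hence "norm (gaussian_kernel ?m t) \<le> sqrt (pi / \<bar>\<tau>\<bar>) * 1"
    unfolding gaussian_kernel_def norm_mult using 1 by (intro mult_mono) auto
  thus ?thesis by simp
qed

lemma gaussian_kernel_measurable [measurable]: "gaussian_kernel m \<in> borel_measurable borel"
  unfolding gaussian_kernel_def by measurable

text \<open>
  This is the estimate that stays bounded as \<open>\<delta>\<close> tends to \<open>0\<close> whether or not \<open>\<tau>\<close> vanishes: for
  \<open>\<tau> \<noteq> 0\<close> the kernel itself is bounded, while for \<open>\<tau> = 0\<close> it is a probability density that
  concentrates at a point.
\<close>

lemma integral_gaussian_kernel_on_interval:
  fixes \<delta> R \<tau> x :: real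
  assumes \<delta>: "\<delta> > 0" and R: "R \<ge> 0"
  defines "w \<equiv> \<lambda>t. indicator {-R..R} t * norm (gaussian_kernel (Complex (pi * \<delta>\<^sup>2) \<tau>) (x - t))"
  shows "integrable lborel w"
    and "(LINT t|lborel. w t) \<le> (if \<tau> = 0 then 1 else 2 * R * sqrt (pi / \<bar>\<tau>\<bar>))"
proof -
  have [measurable]: "w \<in> borel_measurable borel" unfolding w_def by measurable
  have w0: "0 \<le> w t" for t by (simp add: w_def)
  have "integrable lborel w \<and> (LINT t|lborel. w t) \<le> (if \<tau> = 0 then 1 else 2 * R * sqrt (pi / \<bar>\<tau>\<bar>))"
  proof (cases "\<tau> = 0")
    case True
    define e where "e = (\<lambda>t. exp (- pi * ((x - t) / \<delta>)\<^sup>2) / \<delta>)"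
    have [measurable]: "e \<in> borel_measurable borel" unfolding e_def by measurable
    have we: "w t \<le> e t" for t
    proof -
      have "Complex (pi * \<delta>\<^sup>2) \<tau> = of_real (pi * \<delta>\<^sup>2)" using True by (simp add: complex_eq_iff)
      hence "norm (gaussian_kernel (Complex (pi * \<delta>\<^sup>2) \<tau>) (x - t)) = e t"
        using \<delta> by (simp only: gaussian_kernel_real[OF \<delta>] norm_of_real e_def) simp
      thus ?thesis using \<delta> by (simp add: w_def e_def split: split_indicator)
    qed
    have int1: "integrable lborel (\<lambda>t. exp (- pi * t\<^sup>2))" by (rule integrable_gaussian_real) simp
    have "integrable lborel (\<lambda>t. exp (- pi * (x / \<delta> + (- 1 / \<delta>) * t)\<^sup>2))"
      using \<delta> by (intro lborel_integrable_real_affine int1) simp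
    hence "integrable lborel (\<lambda>t. exp (- pi * (x / \<delta> + (- 1 / \<delta>) * t)\<^sup>2) / \<delta>)" by simp
    moreover have "(\<lambda>t. exp (- pi * (x / \<delta> + (- 1 / \<delta>) * t)\<^sup>2) / \<delta>) = e"
      by (simp add: e_def diff_divide_distrib)
    ultimately have int_e: "integrable lborel e" by (simp only:)
    have "(LINT t|lborel. e t) = (LINT z|lborel. \<bar>\<delta>\<bar> ^ DIM(real) *\<^sub>R e (x + \<delta> *\<^sub>R z))"
      using \<delta> by (intro integral_lborel_affine) auto
    also have "\<dots> = (LINT z|lborel. exp (- pi * z\<^sup>2))"
      using \<delta> by (simp add: e_def)
    also have "complex_of_real \<dots> = (LINT z|lborel. complex_of_real (exp (- pi * z\<^sup>2)))"
      by (rule integral_complex_of_real[symmetric])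
    also have "\<dots> = 1" using gaussian_fourier_real[of pi 0] by (simp flip: exp_of_real)
    finally have "(LINT t|lborel. e t) = 1" by (simp only: of_real_eq_1_iff)
    have iw: "integrable lborel w"
      by (rule Bochner_Integration.integrable_bound[OF int_e]) (use we w0 in \<open>auto intro: order_trans[OF _ abs_ge_self]\<close>)
    moreover have "(LINT t|lborel. w t) \<le> 1"
      using integral_mono[OF iw int_e we] \<open>(LINT t|lborel. e t) = 1\<close> by simp
    ultimately show ?thesis using True by simp
  next
    case False
    define q where "q = sqrt (pi / \<bar>\<tau>\<bar>)"
    have we: "w t \<le> indicator {-R..R} t * q" for t
      using norm_gaussian_kernel_le[of "pi * \<delta>\<^sup>2" \<tau> "x - t"] False \<delta>
      by (simp add: w_def q_def split: split_indicator)
    have iq: "integrable lborel (\<lambda>t. indicator {-R..R} t * q)"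
      using R by (intro integrable_mult_left) simp
    have lq: "(LINT t|lborel. indicator {-R..R} t * q) = 2 * R * q"
      using R by simp
    have iw: "integrable lborel w"
      by (rule Bochner_Integration.integrable_bound[OF iq]) (use we w0 in \<open>auto intro: order_trans[OF _ abs_ge_self]\<close>)
    moreover have "(LINT t|lborel. w t) \<le> 2 * R * q"
      using integral_mono[OF iw iq we] unfolding lq .
    ultimately show ?thesis using False by (simp add: q_def)
  qed
  thus "integrable lborel w" "(LINT t|lborel. w t) \<le> (if \<tau> = 0 then 1 else 2 * R * sqrt (pi / \<bar>\<tau>\<bar>))"
    by blast+
qed

text \<open>
  The real part of \<open>1 / m\<close> tends to zero with \<open>\<epsilon>\<close>, the imaginary part only stays bounded.  The former is
  responsible for growth in \<open>\<bar>Re z\<bar>\<close> and the latter for growth in \<open>\<bar>Im z\<bar>\<close> of the analytic extension.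
\<close>

lemma Re_Im_inverse_Complex:
  assumes "\<epsilon> > 0" "\<tau> \<noteq> 0"
  shows "0 \<le> Re (1 / Complex \<epsilon> \<tau>)" "Re (1 / Complex \<epsilon> \<tau>) \<le> \<epsilon> * (1 / \<tau>\<^sup>2)" "\<bar>Im (1 / Complex \<epsilon> \<tau>)\<bar> \<le> 1 / \<bar>\<tau>\<bar>"
proof -
  have t2: "\<tau>\<^sup>2 > 0" using assms by simp
  have le: "\<tau>\<^sup>2 \<le> \<epsilon>\<^sup>2 + \<tau>\<^sup>2" by simp
  have R: "Re (1 / Complex \<epsilon> \<tau>) = \<epsilon> / (\<epsilon>\<^sup>2 + \<tau>\<^sup>2)" and I: "Im (1 / Complex \<epsilon> \<tau>) = - \<tau> / (\<epsilon>\<^sup>2 + \<tau>\<^sup>2)"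
    by (simp_all add: Re_divide Im_divide)
  show "0 \<le> Re (1 / Complex \<epsilon> \<tau>)" using assms unfolding R by (intro divide_nonneg_nonneg) auto
  have "\<epsilon> / (\<epsilon>\<^sup>2 + \<tau>\<^sup>2) \<le> \<epsilon> / \<tau>\<^sup>2"
    using assms t2 by (intro divide_left_mono le mult_pos_pos) (auto intro: add_nonneg_pos)
  thus "Re (1 / Complex \<epsilon> \<tau>) \<le> \<epsilon> * (1 / \<tau>\<^sup>2)" unfolding R by simp
  have "\<bar>Im (1 / Complex \<epsilon> \<tau>)\<bar> = \<bar>\<tau>\<bar> / (\<epsilon>\<^sup>2 + \<tau>\<^sup>2)"
    unfolding I by simp
  also have "\<dots> \<le> \<bar>\<tau>\<bar> / \<tau>\<^sup>2"
    using t2 by (intro divide_left_mono le mult_pos_pos) (auto intro: add_nonneg_pos)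
  also have "\<dots> = 1 / \<bar>\<tau>\<bar>" using assms by (simp add: power2_eq_square abs_if)
  finally show "\<bar>Im (1 / Complex \<epsilon> \<tau>)\<bar> \<le> 1 / \<bar>\<tau>\<bar>" .
qed

text \<open>
  Let \<open>m\<^sub>i = \<epsilon> + \<i> \<tau>\<^sub>i\<close>.  The Gaussian means of the inverse Fourier transform of \<open>u\<close> converge to \<open>u\<close>,
  and by the evolution law they are the convolutions of \<open>f\<close> with the product of the kernels
  \<open>sqrt (\<pi> / m\<^sub>i) exp (- \<pi>\<^sup>2 z\<^sub>i\<^sup>2 / m\<^sub>i)\<close>.  At \<open>x0 + s v\<close> the exponent is a quadratic polynomial in \<open>s\<close> whose
  leading coefficient \<open>W\<close> does not depend on the integration variable.  Removing \<open>exp (s\<^sup>2 W)\<close> leaves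
  an exponential that is linear in \<open>s\<close>, hence an entire function \<open>h\<close> of \<open>s\<close>, with a bound that is
  uniform in \<open>\<epsilon>\<close>.  Since \<open>v\<close> has no component in coordinates with \<open>\<tau>\<^sub>i = 0\<close>, the real part of \<open>W\<close>
  tends to \<open>0\<close>, so that the moduli on the real line are those of \<open>u\<close> in the limit.
\<close>

lemma schroedinger_extends_along_lines:
  fixes u f :: "real^'n \<Rightarrow> complex" and \<tau> :: "'n \<Rightarrow> real" and x0 v :: "real^'n"
  assumes u: "continuous_on UNIV u" "integrable lborel u"
    and f: "continuous_on UNIV f" and R: "R \<ge> 0" and supp: "\<And>y i. f y \<noteq> 0 \<Longrightarrow> \<bar>y $ i\<bar> \<le> R"
    and evol: "\<And>\<xi>. fourier u \<xi> = exp (- \<i> * of_real (\<Sum>i\<in>UNIV. \<tau> i * (\<xi> $ i)\<^sup>2)) * fourier f \<xi>"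
    and v: "\<And>i. \<tau> i = 0 \<Longrightarrow> v $ i = 0"
  obtains H K S where "H holomorphic_on UNIV" "\<And>z. norm (H z) \<le> K * exp (S * \<bar>Im z\<bar>)"
    "\<And>s::real. norm (H (of_real s)) = norm (u (x0 + s *\<^sub>R v))"
proof -
  define box where "box = cbox (\<chi> i. - R) (\<chi> i. R :: real^'n)"
  have box: "y \<in> box \<longleftrightarrow> (\<forall>i. \<bar>y $ i\<bar> \<le> R)" for y
    by (auto simp: box_def mem_box_cart abs_le_iff minus_le_iff)
  have f0: "f y = 0" if "y \<notin> box" for y using supp[of y] that by (auto simp: box)
  have ind_f: "indicator box y *\<^sub>R (f y * g) = f y * g" for y g using f0[of y] by (auto split: split_indicator)
  have int_f: "integrable lborel (\<lambda>y. f y * g y)" if "continuous_on UNIV g" for g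
  proof -
    have "integrable lborel (\<lambda>y. indicator box y *\<^sub>R (f y * g y))"
      by (intro borel_integrable_compact continuous_on_mult continuous_on_subset[OF f] continuous_on_subset[OF that])
        (auto simp: box_def)
    thus ?thesis by (simp only: ind_f)
  qed
  have f_int: "integrable lborel f" using int_f[of "\<lambda>_. 1"] by simp
  have "compact (f ` box)" unfolding box_def
    by (intro compact_continuous_image continuous_on_subset[OF f]) auto
  then obtain M where M: "M > 0" "\<And>y. y \<in> box \<Longrightarrow> norm (f y) \<le> M"
    using compact_imp_bounded bounded_pos by (metis imageI)

  define \<epsilon> where "\<epsilon> = (\<lambda>k. pi * (1 / real (Suc k))\<^sup>2)"
  have \<epsilon>: "\<epsilon> k > 0" "\<epsilon> k \<le> pi" for k
    by (simp_all add: \<epsilon>_def power_le_one mult_left_le)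
  have \<epsilon>_lim: "\<epsilon> \<longlonglongrightarrow> 0"
  proof -
    have "(\<lambda>k. pi * (1 / real (Suc k))\<^sup>2) \<longlonglongrightarrow> pi * 0\<^sup>2"
      by (intro tendsto_intros LIMSEQ_Suc lim_1_over_n)
    thus ?thesis by (simp add: \<epsilon>_def)
  qed
  define m where "m = (\<lambda>k i. Complex (\<epsilon> k) (\<tau> i))"
  have m_pos: "Re (m k i) > 0" for k i using \<epsilon> by (simp add: m_def)
  \<comment> \<open>The Gaussian means of the inversion integral, written as convolutions of \<open>f\<close>.\<close>
  define U where "U = (\<lambda>k x. LINT y|lborel. f y * (\<Prod>i\<in>UNIV. gaussian_kernel (m k i) ((x - y) $ i)))"
  have U_lim: "(\<lambda>k. U k x) \<longlonglongrightarrow> u x" for x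
  proof -
    have "(LINT \<xi>|lborel. fourier u \<xi> * (gaussian (\<lambda>_. of_real (\<epsilon> k)) \<xi> * exp (2 * of_real pi * \<i> * of_real (x \<bullet> \<xi>)))) = U k x" for k
    proof -
      have "fourier u \<xi> * (gaussian (\<lambda>_. of_real (\<epsilon> k)) \<xi> * exp (2 * of_real pi * \<i> * of_real (x \<bullet> \<xi>))) =
          fourier f \<xi> * (gaussian (m k) \<xi> * exp (2 * of_real pi * \<i> * of_real (x \<bullet> \<xi>)))" for \<xi>
      proof -
        have "gaussian (m k) \<xi> = exp (- \<i> * of_real (\<Sum>i\<in>UNIV. \<tau> i * (\<xi> $ i)\<^sup>2)) * gaussian (\<lambda>_. of_real (\<epsilon> k)) \<xi>"
          unfolding gaussian_def exp_add[symmetric] m_def Complex_eq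
          by (simp add: sum_distrib_left sum.distrib sum_negf distrib_right mult.assoc) (simp only: minus_diff_commute)
        thus ?thesis unfolding evol by simp
      qed
      thus ?thesis
        unfolding U_def by (simp only: fourier_multiplication[OF f_int integrable_gaussian_vec[OF m_pos]] fourier_gaussian_vec[OF m_pos])
    qed
    thus ?thesis using fourier_gaussian_inversion[OF u, of x] unfolding \<epsilon>_def by (simp only:)
  qed

  define c where "c = (\<lambda>k. \<Prod>i\<in>UNIV. exp (- Ln (m k i / of_real pi) / 2))"
  define a where "a = (\<lambda>y. x0 - y)"
  define A where "A = (\<lambda>k y. \<Sum>i\<in>UNIV. - of_real ((pi * a y $ i)\<^sup>2) / m k i)"
  define L where "L = (\<lambda>k y. \<Sum>i\<in>UNIV. of_real (- 2 * pi\<^sup>2 * (a y $ i * v $ i)) * (1 / m k i))"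
  define W where "W = (\<lambda>k. \<Sum>i\<in>UNIV. of_real (- ((pi * v $ i)\<^sup>2)) * (1 / m k i))"
  define h where "h = (\<lambda>k z. LINT y|lborel. f y * (c k * exp (A k y + z * L k y)))"
  have m_nz: "m k i \<noteq> 0" for k i using m_pos[of k i] by auto
  have cont_a: "continuous_on X (\<lambda>y. a y $ i)" for X i unfolding a_def by (intro continuous_intros)
  have contA: "continuous_on X (A k)" for k X
    unfolding A_def by (intro continuous_intros cont_a ballI m_nz)
  have contL: "continuous_on X (L k)" for k X
    unfolding L_def by (intro continuous_intros cont_a ballI m_nz)
  have U_h: "U k (x0 + s *\<^sub>R v) = exp (of_real (s\<^sup>2) * W k) * h k (of_real s)" for k s
  proof -
    have "(\<Prod>i\<in>UNIV. gaussian_kernel (m k i) ((x0 + s *\<^sub>R v - y) $ i)) =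
        exp (of_real (s\<^sup>2) * W k) * (c k * exp (A k y + of_real s * L k y))" for y
    proof -
      have "(\<Sum>i\<in>UNIV. - of_real ((pi * ((x0 + s *\<^sub>R v - y) $ i))\<^sup>2) / m k i) = of_real (s\<^sup>2) * W k + (A k y + of_real s * L k y)"
        unfolding W_def A_def L_def sum_distrib_left sum.distrib[symmetric]
      proof (rule sum.cong[OF refl])
        fix i
        have "(pi * ((x0 + s *\<^sub>R v - y) $ i))\<^sup>2 = s\<^sup>2 * (pi * v $ i)\<^sup>2 + (pi * a y $ i)\<^sup>2 + s * (2 * pi\<^sup>2 * (a y $ i * v $ i))"
          by (simp add: a_def power2_eq_square algebra_simps)
        thus "- of_real ((pi * ((x0 + s *\<^sub>R v - y) $ i))\<^sup>2) / m k i =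
          of_real (s\<^sup>2) * (of_real (- ((pi * v $ i)\<^sup>2)) * (1 / m k i)) +
          (- of_real ((pi * a y $ i)\<^sup>2) / m k i + of_real s * (of_real (- 2 * pi\<^sup>2 * (a y $ i * v $ i)) * (1 / m k i)))"
          by (simp only: of_real_add of_real_mult of_real_minus) (simp add: divide_inverse algebra_simps)
      qed
      moreover have "(\<Prod>i\<in>UNIV. exp (- Ln (m k i / of_real pi) / 2)) = c k" by (simp only: c_def)
      ultimately have "(\<Prod>i\<in>UNIV. gaussian_kernel (m k i) ((x0 + s *\<^sub>R v - y) $ i)) =
          c k * exp (of_real (s\<^sup>2) * W k + (A k y + of_real s * L k y))"
        unfolding gaussian_kernel_def prod.distrib by (simp only: exp_sum[OF finite, symmetric])
      thus ?thesis by (simp only: exp_add mult_ac)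
    qed
    thus ?thesis unfolding U_def h_def
      by (simp only: mult.left_commute[of "f _" "exp (of_real (s\<^sup>2) * W k)"] integral_mult_right_zero)
  qed

  have h_hol: "h k holomorphic_on UNIV" for k
  proof -
    have eq: "h k z = integral box (\<lambda>y. f y * (c k * exp (A k y + z * L k y)))" for z
    proof -
      have "set_integrable lborel box (\<lambda>y. f y * (c k * exp (A k y + z * L k y)))"
        unfolding set_integrable_def ind_f by (intro int_f continuous_intros contA contL)
      from set_borel_integral_eq_integral(2)[OF this] show ?thesis
        unfolding set_lebesgue_integral_def ind_f h_def .
    qed
    define d where "d = (\<lambda>z y. f y * (c k * (exp (A k y + z * L k y) * L k y)))"
    have "(\<lambda>z. integral box (\<lambda>y. f y * (c k * exp (A k y + z * L k y)))) holomorphic_on UNIV"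
      unfolding box_def
    proof (rule leibniz_rule_holomorphic[where fx = d])
      show "((\<lambda>z. f y * (c k * exp (A k y + z * L k y))) has_field_derivative d z y) (at z within UNIV)" for z y
        unfolding d_def by (auto intro!: derivative_eq_intros)
      show "(\<lambda>y. f y * (c k * exp (A k y + z * L k y))) integrable_on cbox (\<chi> i. - R) (\<chi> i. R)" for z
        by (intro integrable_continuous continuous_intros contA contL continuous_on_subset[OF f]) auto
      show "continuous_on (UNIV \<times> cbox (\<chi> i. - R) (\<chi> i. R)) (\<lambda>(z, y). d z y)"
        unfolding d_def split_beta
        by (intro continuous_intros continuous_on_compose2[OF f] continuous_on_compose2[OF contA[of UNIV]]
            continuous_on_compose2[OF contL[of UNIV]]) auto
    qed auto
    thus ?thesis by (simp only: eq[abs_def])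
  qed

  \<comment> \<open>A bound for the linear coefficient \<open>L\<close> on the support of \<open>f\<close>.  Division by zero contributes \<open>0\<close> for
    \<open>\<tau> i = 0\<close>, in agreement with \<open>v $ i = 0\<close>.\<close>
  define S where "S = (\<Sum>i\<in>UNIV. 2 * pi\<^sup>2 * ((\<bar>x0 $ i\<bar> + R) * \<bar>v $ i\<bar>) * (1 / (\<tau> i)\<^sup>2 + 1 / \<bar>\<tau> i\<bar>))"
  have L_bd: "\<bar>Re (L k y)\<bar> \<le> \<epsilon> k * S" "\<bar>Im (L k y)\<bar> \<le> S" if y: "y \<in> box" for k y
  proof -
    define p where "p = (\<lambda>i. 2 * pi\<^sup>2 * ((\<bar>x0 $ i\<bar> + R) * \<bar>v $ i\<bar>))"
    have p0: "p i \<ge> 0" for i using R by (simp add: p_def)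
    have q: "\<bar>- 2 * pi\<^sup>2 * (a y $ i * v $ i)\<bar> \<le> p i" for i
    proof -
      have "\<bar>a y $ i\<bar> \<le> \<bar>x0 $ i\<bar> + R" using y[unfolded box, rule_format, of i] by (simp add: a_def)
      hence "\<bar>a y $ i\<bar> * \<bar>v $ i\<bar> \<le> (\<bar>x0 $ i\<bar> + R) * \<bar>v $ i\<bar>" by (rule mult_right_mono) simp
      thus ?thesis by (simp add: p_def abs_mult mult_left_mono)
    qed
    have "\<bar>Re (L k y)\<bar> \<le> (\<Sum>i\<in>UNIV. \<bar>(- 2 * pi\<^sup>2 * (a y $ i * v $ i)) * Re (1 / m k i)\<bar>)"
      unfolding L_def Re_sum Re_of_real_mult by (rule sum_abs)
    also have "\<dots> \<le> (\<Sum>i\<in>UNIV. \<epsilon> k * (p i * (1 / (\<tau> i)\<^sup>2 + 1 / \<bar>\<tau> i\<bar>)))"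
    proof (rule sum_mono)
      fix i
      show "\<bar>(- 2 * pi\<^sup>2 * (a y $ i * v $ i)) * Re (1 / m k i)\<bar> \<le> \<epsilon> k * (p i * (1 / (\<tau> i)\<^sup>2 + 1 / \<bar>\<tau> i\<bar>))"
      proof (cases "\<tau> i = 0")
        case False
        note ri = Re_Im_inverse_Complex[OF \<epsilon>(1)[of k] False]
        have "\<bar>(- 2 * pi\<^sup>2 * (a y $ i * v $ i)) * Re (1 / m k i)\<bar> \<le> p i * (\<epsilon> k * (1 / (\<tau> i)\<^sup>2))"
          unfolding abs_mult[of "- 2 * pi\<^sup>2 * (a y $ i * v $ i)"] m_def using ri q p0 by (intro mult_mono) auto
        also have "\<dots> \<le> p i * (\<epsilon> k * (1 / (\<tau> i)\<^sup>2 + 1 / \<bar>\<tau> i\<bar>))"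
          using p0[of i] \<epsilon>(1)[of k] by (intro mult_left_mono) auto
        finally show ?thesis by (simp only: mult_ac)
      qed (use v in simp)
    qed
    also have "\<dots> = \<epsilon> k * S" unfolding S_def p_def sum_distrib_left ..
    finally show "\<bar>Re (L k y)\<bar> \<le> \<epsilon> k * S" .
    have "\<bar>Im (L k y)\<bar> \<le> (\<Sum>i\<in>UNIV. \<bar>(- 2 * pi\<^sup>2 * (a y $ i * v $ i)) * Im (1 / m k i)\<bar>)"
      unfolding L_def Im_sum Im_of_real_mult by (rule sum_abs)
    also have "\<dots> \<le> (\<Sum>i\<in>UNIV. p i * (1 / (\<tau> i)\<^sup>2 + 1 / \<bar>\<tau> i\<bar>))"
    proof (rule sum_mono)
      fix i
      show "\<bar>(- 2 * pi\<^sup>2 * (a y $ i * v $ i)) * Im (1 / m k i)\<bar> \<le> p i * (1 / (\<tau> i)\<^sup>2 + 1 / \<bar>\<tau> i\<bar>)"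
      proof (cases "\<tau> i = 0")
        case False
        note ri = Re_Im_inverse_Complex[OF \<epsilon>(1)[of k] False]
        have "\<bar>(- 2 * pi\<^sup>2 * (a y $ i * v $ i)) * Im (1 / m k i)\<bar> \<le> p i * (1 / \<bar>\<tau> i\<bar>)"
          unfolding abs_mult[of "- 2 * pi\<^sup>2 * (a y $ i * v $ i)"] m_def using ri q p0 by (intro mult_mono) auto
        also have "\<dots> \<le> p i * (1 / (\<tau> i)\<^sup>2 + 1 / \<bar>\<tau> i\<bar>)"
          using p0[of i] by (intro mult_left_mono) auto
        finally show ?thesis .
      qed (use v in simp)
    qed
    also have "\<dots> = S" unfolding S_def p_def ..
    finally show "\<bar>Im (L k y)\<bar> \<le> S" .
  qed
  have S0: "S \<ge> 0" unfolding S_def using R by (intro sum_nonneg mult_nonneg_nonneg) auto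

  define Q where "Q = (\<Prod>i\<in>UNIV. if \<tau> i = 0 then 1 else 2 * R * sqrt (pi / \<bar>\<tau> i\<bar>))"
  have h_bd: "norm (h k z) \<le> M * Q * exp (S * (\<epsilon> k * \<bar>Re z\<bar> + \<bar>Im z\<bar>))" for k z
  proof -
    define w where "w = (\<lambda>i t. indicator {-R..R} t * norm (gaussian_kernel (m k i) (x0 $ i - t)))"
    have w0: "w i t \<ge> 0" for i t by (simp add: w_def)
    have dk: "1 / real (Suc k) > 0" by simp
    have w_int: "integrable lborel (w i)" for i
      unfolding w_def m_def \<epsilon>_def by (rule integral_gaussian_kernel_on_interval(1)[OF dk R])
    have w_le: "(LINT t|lborel. w i t) \<le> (if \<tau> i = 0 then 1 else 2 * R * sqrt (pi / \<bar>\<tau> i\<bar>))" for i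
      unfolding w_def m_def \<epsilon>_def by (rule integral_gaussian_kernel_on_interval(2)[OF dk R])
    define E where "E = exp (S * (\<epsilon> k * \<bar>Re z\<bar> + \<bar>Im z\<bar>))"
    \<comment> \<open>On the support of \<open>f\<close> the exponential of \<open>z * L k y\<close> costs a constant factor, and what remains is the
      kernel at \<open>x0 - y\<close>, a product of functions of one coordinate.\<close>
    have pw: "norm (f y * (c k * exp (A k y + z * L k y))) \<le> (M * E) * (\<Prod>i\<in>UNIV. w i (y $ i))" for y
    proof (cases "y \<in> box")
      case True
      have "c k * exp (A k y) = (\<Prod>i\<in>UNIV. gaussian_kernel (m k i) (x0 $ i - y $ i))"
        unfolding gaussian_kernel_def prod.distrib c_def A_def a_def exp_sum[OF finite] by simp
      hence "norm (c k * exp (A k y)) = (\<Prod>i\<in>UNIV. norm (gaussian_kernel (m k i) (x0 $ i - y $ i)))"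
        by (simp only: prod_norm)
      also have "\<dots> = (\<Prod>i\<in>UNIV. w i (y $ i))"
      proof (rule prod.cong[OF refl])
        fix i
        have "y $ i \<in> {-R..R}" using True[unfolded box, rule_format, of i] by auto
        thus "norm (gaussian_kernel (m k i) (x0 $ i - y $ i)) = w i (y $ i)" by (simp add: w_def)
      qed
      finally have 1: "norm (c k * exp (A k y)) = (\<Prod>i\<in>UNIV. w i (y $ i))" .
      have "Re (z * L k y) \<le> \<bar>Re z\<bar> * \<bar>Re (L k y)\<bar> + \<bar>Im z\<bar> * \<bar>Im (L k y)\<bar>"
        unfolding times_complex.sel abs_mult[symmetric] by linarith
      also have "\<dots> \<le> \<bar>Re z\<bar> * (\<epsilon> k * S) + \<bar>Im z\<bar> * S"
        using L_bd[OF True] by (intro add_mono mult_left_mono) auto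
      also have "\<dots> = S * (\<epsilon> k * \<bar>Re z\<bar> + \<bar>Im z\<bar>)" by (simp add: algebra_simps)
      finally have 2: "norm (exp (z * L k y)) \<le> E" by (simp add: E_def)
      have "norm (f y * (c k * exp (A k y + z * L k y))) = norm (f y) * norm (exp (z * L k y)) * (\<Prod>i\<in>UNIV. w i (y $ i))"
        unfolding 1[symmetric] exp_add norm_mult by (simp only: mult_ac)
      also have "\<dots> \<le> (M * E) * (\<Prod>i\<in>UNIV. w i (y $ i))"
        using M True 2 w0 by (intro mult_right_mono mult_mono prod_nonneg) (auto simp: less_imp_le)
      finally show ?thesis .
    next
      case False
      have "0 \<le> (M * E) * (\<Prod>i\<in>UNIV. w i (y $ i))"
        using M(1) w0 by (intro mult_nonneg_nonneg prod_nonneg) (auto simp: E_def)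
      thus ?thesis using f0[OF False] by simp
    qed
    have "norm (h k z) \<le> (LINT y|lborel. (M * E) * (\<Prod>i\<in>UNIV. w i (y $ i)))"
      unfolding h_def
    proof (rule Bochner_Integration.integral_norm_bound_integral)
      show "integrable lborel (\<lambda>y. f y * (c k * exp (A k y + z * L k y)))"
        by (intro int_f continuous_intros contA contL)
      show "integrable lborel (\<lambda>y::real^'n. (M * E) * (\<Prod>i\<in>UNIV. w i (y $ i)))"
        by (intro integrable_mult_right integrable_prod_vec w_int)
    qed (rule pw)
    also have "\<dots> = (M * E) * (\<Prod>i\<in>UNIV. LINT t|lborel. w i t)"
      using integral_prod_vec[of w, OF w_int] by (simp only: integral_mult_right_zero)
    also have "\<dots> \<le> (M * E) * Q"
      unfolding Q_def using M(1) w_le w0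
      by (intro mult_left_mono prod_mono conjI integral_nonneg_AE) (auto simp: E_def)
    finally show ?thesis by (simp only: E_def mult_ac)
  qed
  have Q0: "Q \<ge> 0" unfolding Q_def using R by (intro prod_nonneg) auto

  \<comment> \<open>The bounds are uniform in \<open>k\<close> on compact sets, so the extensions form a normal family.\<close>
  have bd_compact: "\<exists>B. \<forall>g\<in>range h. \<forall>z\<in>X. norm (g z) \<le> B" if "compact X" "X \<subseteq> UNIV" for X
  proof -
    obtain r where r: "\<And>z. z \<in> X \<Longrightarrow> norm z \<le> r"
      using compact_imp_bounded[OF \<open>compact X\<close>] unfolding bounded_iff by blast
    have "norm (h k z) \<le> M * Q * exp (S * (pi * r + r))" if "z \<in> X" for k z
    proof -
      have "\<epsilon> k * \<bar>Re z\<bar> + \<bar>Im z\<bar> \<le> pi * r + r"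
        using r[OF that] \<epsilon>[of k] abs_Re_le_cmod[of z] abs_Im_le_cmod[of z] by (intro add_mono mult_mono) auto
      hence "M * Q * exp (S * (\<epsilon> k * \<bar>Re z\<bar> + \<bar>Im z\<bar>)) \<le> M * Q * exp (S * (pi * r + r))"
        using S0 Q0 M(1) by (intro mult_left_mono) (auto intro: mult_left_mono)
      thus ?thesis using h_bd[of k z] by linarith
    qed
    thus ?thesis by blast
  qed
  have hol_range: "g holomorphic_on UNIV" if "g \<in> range h" for g using that h_hol by auto
  obtain H r where H: "H holomorphic_on UNIV" "strict_mono (r :: nat \<Rightarrow> nat)"
      "\<And>z. (\<lambda>n. h (r n) z) \<longlonglongrightarrow> H z"
  proof (rule Montel[OF open_UNIV hol_range bd_compact order_refl[of "range h"]])
    fix g r assume "g holomorphic_on UNIV" "strict_mono (r :: nat \<Rightarrow> nat)"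
      and *: "\<And>z. z \<in> UNIV \<Longrightarrow> (\<lambda>n. h (r n) z) \<longlonglongrightarrow> g z"
    show thesis by (rule that[of g r]) (fact | rule *[OF UNIV_I])+
  qed
  have \<epsilon>r: "(\<lambda>n. \<epsilon> (r n)) \<longlonglongrightarrow> 0"
    using LIMSEQ_subseq_LIMSEQ[OF \<epsilon>_lim H(2)] by (simp add: o_def)
  have H_bd: "norm (H z) \<le> M * Q * exp (S * \<bar>Im z\<bar>)" for z
  proof (rule LIMSEQ_le)
    show "(\<lambda>n. norm (h (r n) z)) \<longlonglongrightarrow> norm (H z)" by (intro tendsto_norm H)
    have "(\<lambda>n. M * Q * exp (S * (\<epsilon> (r n) * \<bar>Re z\<bar> + \<bar>Im z\<bar>))) \<longlonglongrightarrow> M * Q * exp (S * (0 * \<bar>Re z\<bar> + \<bar>Im z\<bar>))"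
      by (intro tendsto_intros \<epsilon>r)
    thus "(\<lambda>n. M * Q * exp (S * (\<epsilon> (r n) * \<bar>Re z\<bar> + \<bar>Im z\<bar>))) \<longlonglongrightarrow> M * Q * exp (S * \<bar>Im z\<bar>)" by simp
  qed (use h_bd in blast)
  have "norm (H (of_real s)) = norm (u (x0 + s *\<^sub>R v))" for s :: real
  proof -
    have W_lim: "(\<lambda>k. Re (W k)) \<longlonglongrightarrow> 0"
    proof -
      have "(\<lambda>k. Re (of_real (- ((pi * v $ i)\<^sup>2)) * (1 / m k i))) \<longlonglongrightarrow> 0" for i
      proof (cases "\<tau> i = 0")
        case False
        note ri = Re_Im_inverse_Complex[OF \<epsilon>(1) False]
        have "(\<lambda>k. Re (1 / m k i)) \<longlonglongrightarrow> 0"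
        proof (rule tendsto_sandwich[OF _ _ tendsto_const])
          show "(\<lambda>k. \<epsilon> k * (1 / (\<tau> i)\<^sup>2)) \<longlonglongrightarrow> 0" by (rule tendsto_mult_left_zero[OF \<epsilon>_lim])
        qed (use ri(1,2) in \<open>auto simp only: m_def intro!: always_eventually\<close>)
        thus ?thesis unfolding Re_of_real_mult by (rule tendsto_mult_right_zero)
      qed (use v in simp)
      hence "(\<lambda>k. \<Sum>i\<in>UNIV. Re (of_real (- ((pi * v $ i)\<^sup>2)) * (1 / m k i))) \<longlonglongrightarrow> (\<Sum>i\<in>(UNIV::'n set). 0)"
        by (intro tendsto_sum)
      thus ?thesis unfolding W_def Re_sum by simp
    qed
    have "(\<lambda>k. norm (U k (x0 + s *\<^sub>R v)) * exp (- (s\<^sup>2 * Re (W k)))) \<longlonglongrightarrow> norm (u (x0 + s *\<^sub>R v)) * exp (- (s\<^sup>2 * 0))"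
      by (intro tendsto_intros U_lim W_lim)
    moreover have "norm (U k (x0 + s *\<^sub>R v)) * exp (- (s\<^sup>2 * Re (W k))) = norm (h k (of_real s))" for k
      unfolding U_h norm_mult norm_exp_eq_Re Re_of_real_mult by (simp add: exp_minus)
    ultimately have "(\<lambda>k. norm (h k (of_real s))) \<longlonglongrightarrow> norm (u (x0 + s *\<^sub>R v))" by simp
    from LIMSEQ_subseq_LIMSEQ[OF this H(2)]
    have "(\<lambda>n. norm (h (r n) (of_real s))) \<longlonglongrightarrow> norm (u (x0 + s *\<^sub>R v))" by (simp add: o_def)
    thus ?thesis using tendsto_norm[OF H(3)] LIMSEQ_unique by blast
  qed
  thus ?thesis using that[OF H(1) H_bd] by blast
qed

section \<open>Radial functions and lower integrals\<close>

text \<open>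
  The point is that \<open>f\<close> is arbitrary: additivity of the lower integral can fail for sums of
  non-measurable functions, but it survives decomposition of the domain into measurable pieces.
\<close>

lemma nn_integral_Un_le:
  assumes [measurable]: "A \<in> sets M" "B \<in> sets M"
  shows "(\<integral>\<^sup>+x. f x * indicator (A \<union> B) x \<partial>M) \<le> (\<integral>\<^sup>+x. f x * indicator A x \<partial>M) + (\<integral>\<^sup>+x. f x * indicator B x \<partial>M)"
  unfolding nn_integral_def[of M "\<lambda>x. f x * indicator (A \<union> B) x"]
proof (rule SUP_least, clarify)
  fix g assume g: "simple_function M g" "g \<le> (\<lambda>x. f x * indicator (A \<union> B) x)"
  have [measurable]: "g \<in> borel_measurable M" using g(1) by (rule borel_measurable_simple_function)
  have le: "g x \<le> f x * indicator (A \<union> B) x" for x using g(2) by (simp add: le_fun_def)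
  have "integral\<^sup>S M g = (\<integral>\<^sup>+x. g x \<partial>M)" using nn_integral_eq_simple_integral[OF g(1)] by simp
  also have "\<dots> \<le> (\<integral>\<^sup>+x. g x * indicator A x + g x * indicator B x \<partial>M)"
  proof (rule nn_integral_mono)
    fix x
    show "g x \<le> g x * indicator A x + g x * indicator B x"
      using le[of x] by (auto split: split_indicator)
  qed
  also have "\<dots> = (\<integral>\<^sup>+x. g x * indicator A x \<partial>M) + (\<integral>\<^sup>+x. g x * indicator B x \<partial>M)"
    by (rule nn_integral_add) measurable
  also have "\<dots> \<le> (\<integral>\<^sup>+x. f x * indicator A x \<partial>M) + (\<integral>\<^sup>+x. f x * indicator B x \<partial>M)"
  proof (intro add_mono nn_integral_mono)
    fix x
    show "g x * indicator A x \<le> f x * indicator A x" "g x * indicator B x \<le> f x * indicator B x"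
      using le[of x] by (auto split: split_indicator)
  qed
  finally show "integral\<^sup>S M g \<le> \<dots>" .
qed

lemma nn_integral_lebesgue_lower_bound:
  fixes f :: "'a::euclidean_space \<Rightarrow> ennreal"
  assumes "\<And>g. g \<in> borel_measurable borel \<Longrightarrow> (\<And>x. g x \<le> f x) \<Longrightarrow> (\<integral>\<^sup>+x. g x \<partial>lborel) \<le> B"
  shows "(\<integral>\<^sup>+x. f x \<partial>lebesgue) \<le> B"
  unfolding nn_integral_completion nn_integral_def[of lborel f]
proof (rule SUP_least, clarify)
  fix g assume g: "simple_function lborel g" "g \<le> f"
  have "integral\<^sup>S lborel g = (\<integral>\<^sup>+x. g x \<partial>lborel)" using nn_integral_eq_simple_integral[OF g(1)] by simp
  also have "\<dots> \<le> B"
    using borel_measurable_simple_function[OF g(1)] g(2) by (intro assms) (auto simp: le_fun_def)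
  finally show "integral\<^sup>S lborel g \<le> B" .
qed

text \<open>
  Polar coordinates for radial integrands: the norm carries Lebesgue measure to the density
  \<open>d/dr (V r\<^sup>n)\<close>.  Both measures have total mass \<open>V b\<^sup>n\<close> and agree on the half lines \<open>(x, \<infinity>)\<close>.  The
  restriction to a ball keeps them finite.
\<close>

lemma distr_norm_lborel:
  fixes b :: real
  assumes b: "b \<ge> 0"
  defines "V \<equiv> unit_ball_vol (real CARD('n))"
  shows "distr (density lborel (indicator (cball (0::real^'n) b))) borel norm =
         density lborel (\<lambda>r. ennreal (V * (real CARD('n) * r ^ (CARD('n) - 1))) * indicator {0..b} r)"
    (is "?N1 = ?N2")
proof (rule measure_eqI_lessThan)
  have V: "V \<ge> 0" by (simp add: V_def)
  have ball: "emeasure lborel (cball (0::real^'n) r) = ennreal (V * r ^ CARD('n))" if "r \<ge> 0" for r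
    using emeasure_cball[OF that, of "0::real^'n"] by (simp add: V_def)
  have N1: "emeasure ?N1 {x<..} = emeasure lborel (cball (0::real^'n) b \<inter> {y. x < norm y})" for x
  proof -
    have [measurable]: "(indicator (cball (0::real^'n) b) :: _ \<Rightarrow> ennreal) \<in> borel_measurable borel"
      by (intro borel_measurable_indicator) auto
    have S: "{y::real^'n. x < norm y} \<in> sets borel" by measurable
    have "emeasure ?N1 {x<..} = emeasure (density lborel (indicator (cball (0::real^'n) b))) {y. x < norm y}"
      by (subst emeasure_distr) (auto simp: vimage_def)
    also have "\<dots> = (\<integral>\<^sup>+y. indicator (cball (0::real^'n) b) y * indicator {y. x < norm y} y \<partial>lborel)"
      using S by (subst emeasure_density) auto
    also have "\<dots> = (\<integral>\<^sup>+y. indicator (cball (0::real^'n) b \<inter> {y. x < norm y}) y \<partial>lborel)"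
      by (simp only: indicator_inter_arith)
    also have "\<dots> = emeasure lborel (cball (0::real^'n) b \<inter> {y. x < norm y})"
      using S by (intro nn_integral_indicator) auto
    finally show ?thesis .
  qed
  have N1_val: "emeasure ?N1 {x<..} = (if x < b then ennreal (V * b ^ CARD('n) - V * (max 0 x) ^ CARD('n)) else 0)" for x
  proof (cases "x < b")
    case True
    show ?thesis
    proof (cases "x < 0")
      case True
      hence "cball (0::real^'n) b \<inter> {y. x < norm y} = cball 0 b" by (auto intro: less_le_trans)
      thus ?thesis using \<open>x < b\<close> True ball[OF b] by (simp add: N1 power_0_left)
    next
      case False
      hence "cball (0::real^'n) b \<inter> {y. x < norm y} = cball 0 b - cball 0 x" by auto
      moreover have "emeasure lborel (cball (0::real^'n) b - cball 0 x) = emeasure lborel (cball (0::real^'n) b) - emeasure lborel (cball (0::real^'n) x)"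
        using True False by (intro emeasure_Diff) (auto simp: ball ennreal_neq_top)
      ultimately show ?thesis using True False V b by (simp add: N1 ball ennreal_minus)
    qed
  next
    case False
    hence "cball (0::real^'n) b \<inter> {y. x < norm y} = {}" by auto
    thus ?thesis using False by (simp add: N1)
  qed
  have N2_val: "emeasure ?N2 {x<..} = (if x < b then ennreal (V * b ^ CARD('n) - V * (max 0 x) ^ CARD('n)) else 0)" for x
  proof -
    let ?w = "\<lambda>r. V * (real CARD('n) * r ^ (CARD('n) - 1))"
    have e: "emeasure ?N2 {x<..} = (\<integral>\<^sup>+r. ennreal (?w r) * indicator {0..b} r * indicator {x<..} r \<partial>lborel)"
      by (subst emeasure_density) auto
    show ?thesis
    proof (cases "x < b")
      case True
      have "(\<integral>\<^sup>+r. ennreal (?w r) * indicator {0..b} r * indicator {x<..} r \<partial>lborel) =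
            (\<integral>\<^sup>+r. ennreal (?w r) * indicator {max 0 x..b} r \<partial>lborel)"
      proof (rule nn_integral_cong_AE)
        show "AE r in lborel. ennreal (?w r) * indicator {0..b} r * indicator {x<..} r = ennreal (?w r) * indicator {max 0 x..b} r"
          using AE_lborel_singleton[of x] by eventually_elim (auto split: split_indicator)
      qed
      also have "\<dots> = ennreal (V * b ^ CARD('n) - V * (max 0 x) ^ CARD('n))"
        using V True b by (intro nn_integral_FTC_Icc) (auto intro!: derivative_eq_intros)
      finally show ?thesis using True e by simp
    next
      case False
      have "ennreal (?w r) * indicator {0..b} r * indicator {x<..} r = 0" for r
        using False by (auto split: split_indicator)
      hence "emeasure ?N2 {x<..} = (\<integral>\<^sup>+r. 0 \<partial>(lborel :: real measure))" unfolding e by (simp only:)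
      thus ?thesis using False by simp
    qed
  qed
  show "emeasure ?N1 {x<..} < \<infinity>" for x by (simp add: N1_val)
  show "emeasure ?N1 {x<..} = emeasure ?N2 {x<..}" for x by (simp only: N1_val N2_val)
qed auto

text \<open>
  In polar coordinates \<open>\<psi>\<close> is integrated against \<open>c r\<^sup>n\<^sup>-\<^sup>1 dr\<close>, which is at least \<open>c dr\<close> for \<open>r \<ge> 1\<close>.
  Nothing similar holds near \<open>r = 0\<close>, where \<open>\<rho>\<close> may fail to be integrable.
\<close>

lemma radial_profile_integrable:
  fixes \<psi> :: "real^'n \<Rightarrow> real"
  assumes loc: "locally_integrable \<psi>" and nonneg: "\<And>x. \<psi> x \<ge> 0" and radial: "\<And>x. \<psi> x = \<rho> (norm x)"
    and b: "b \<ge> 0"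
  shows "(\<integral>\<^sup>+r\<in>{1..b}. ennreal (\<rho> r) \<partial>lebesgue) < \<infinity>"
proof -
  define c where "c = unit_ball_vol (real CARD('n)) * real CARD('n)"
  have c: "c > 0" by (simp add: c_def)
  have "integrable lebesgue (\<lambda>x. indicator (cball 0 b) x *\<^sub>R \<psi> x)"
    using loc unfolding locally_integrable_def set_integrable_def by auto
  hence I: "(\<integral>\<^sup>+x. ennreal (norm (indicator (cball 0 b) x *\<^sub>R \<psi> x)) \<partial>lebesgue) < \<infinity>" (is "?I < _")
    unfolding integrable_iff_bounded by blast
  have "(\<integral>\<^sup>+r\<in>{1..b}. ennreal (\<rho> r) \<partial>lebesgue) \<le> ennreal (1 / c) * ?I"
  proof (rule nn_integral_lebesgue_lower_bound)
    fix g :: "real \<Rightarrow> ennreal"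
    assume g[measurable]: "g \<in> borel_measurable borel" and le: "\<And>r. g r \<le> ennreal (\<rho> r) * indicator {1..b} r"
    let ?w = "\<lambda>r::real. unit_ball_vol (real CARD('n)) * (real CARD('n) * r ^ (CARD('n) - 1))"
    have "ennreal c * (\<integral>\<^sup>+r. g r \<partial>lborel) = (\<integral>\<^sup>+r. ennreal c * g r \<partial>lborel)"
      by (subst nn_integral_cmult) auto
    also have "\<dots> \<le> (\<integral>\<^sup>+r. (ennreal (?w r) * indicator {0..b} r) * g r \<partial>lborel)"
    proof (rule nn_integral_mono)
      fix r
      show "ennreal c * g r \<le> (ennreal (?w r) * indicator {0..b} r) * g r"
      proof (cases "r \<in> {1..b}")
        case True
        have "c * 1 \<le> c * r ^ (CARD('n) - 1)"
          using True c by (intro mult_left_mono one_le_power) auto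
        hence "ennreal c \<le> ennreal (?w r)" by (intro ennreal_leI) (simp add: c_def mult.assoc)
        thus ?thesis using True by (auto intro: mult_right_mono)
      next
        case False
        hence "g r = 0" using le[of r] by simp
        thus ?thesis by simp
      qed
    qed
    also have "\<dots> = (\<integral>\<^sup>+r. g r \<partial>(density lborel (\<lambda>r. ennreal (?w r) * indicator {0..b} r)))"
      by (subst nn_integral_density) auto
    also have "\<dots> = (\<integral>\<^sup>+x. indicator (cball (0::real^'n) b) x * g (norm x) \<partial>lborel)"
    proof -
      have [measurable]: "(indicator (cball (0::real^'n) b) :: _ \<Rightarrow> ennreal) \<in> borel_measurable borel"
        by (intro borel_measurable_indicator) auto
      have "(\<integral>\<^sup>+x. g x \<partial>(distr (density lborel (indicator (cball (0::real^'n) b))) borel norm)) =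
          (\<integral>\<^sup>+x. g (norm x) \<partial>(density lborel (indicator (cball (0::real^'n) b))))"
        by (intro nn_integral_distr) auto
      also have "\<dots> = (\<integral>\<^sup>+x. indicator (cball (0::real^'n) b) x * g (norm x) \<partial>lborel)"
        by (intro nn_integral_density) auto
      finally show ?thesis unfolding distr_norm_lborel[OF b, where 'n = 'n] .
    qed
    also have "\<dots> = (\<integral>\<^sup>+x. indicator (cball (0::real^'n) b) x * g (norm x) \<partial>lebesgue)"
      by (rule nn_integral_completion[symmetric])
    also have "\<dots> \<le> ?I"
    proof (rule nn_integral_mono)
      fix x :: "real^'n"
      have "g (norm x) \<le> ennreal (\<psi> x)"
        using le[of "norm x"] unfolding radial by (auto split: split_indicator_asm)
      thus "indicator (cball 0 b) x * g (norm x) \<le> ennreal (norm (indicator (cball 0 b) x *\<^sub>R \<psi> x))"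
        using nonneg[of x] by (auto split: split_indicator)
    qed
    finally have "ennreal c * (\<integral>\<^sup>+r. g r \<partial>lborel) \<le> ?I" .
    hence "ennreal (1 / c) * (ennreal c * (\<integral>\<^sup>+r. g r \<partial>lborel)) \<le> ennreal (1 / c) * ?I"
      by (rule mult_left_mono) simp
    moreover have "ennreal (1 / c) * ennreal c = 1" using c by (simp flip: ennreal_mult)
    ultimately show "(\<integral>\<^sup>+r. g r \<partial>lborel) \<le> ennreal (1 / c) * ?I"
      by (simp flip: mult.assoc)
  qed
  also have "\<dots> < \<infinity>" using I by (simp add: ennreal_mult_less_top)
  finally show ?thesis .
qed

text \<open>
  Divergence over \<open>[1, \<infinity>)\<close> is divergence at infinity, since \<open>[1, b]\<close> contributes a finite amount.
\<close>

lemma exterior_divergence: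
  fixes \<psi> :: "real^'n \<Rightarrow> real"
  assumes loc: "locally_integrable \<psi>" and nonneg: "\<And>x. \<psi> x \<ge> 0" and radial: "\<And>x. \<psi> x = \<rho> (norm x)"
    and b: "b \<ge> 0" and div: "(\<integral>\<^sup>+r\<in>{1..}. ennreal (\<rho> r / (1 + r\<^sup>2)) \<partial>lebesgue) = \<infinity>"
  shows "(\<integral>\<^sup>+r\<in>{b<..}. ennreal (\<rho> r / (1 + r\<^sup>2)) \<partial>lebesgue) = \<infinity>"
proof -
  let ?f = "\<lambda>r. ennreal (\<rho> r / (1 + r\<^sup>2))"
  have "(\<integral>\<^sup>+r\<in>{1..}. ?f r \<partial>lebesgue) \<le> (\<integral>\<^sup>+r\<in>({1..b} \<union> {b<..}). ?f r \<partial>lebesgue)"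
    by (intro nn_integral_mono) (auto split: split_indicator)
  also have "\<dots> \<le> (\<integral>\<^sup>+r\<in>{1..b}. ?f r \<partial>lebesgue) + (\<integral>\<^sup>+r\<in>{b<..}. ?f r \<partial>lebesgue)"
    by (rule nn_integral_Un_le) auto
  finally have "(\<integral>\<^sup>+r\<in>{1..b}. ?f r \<partial>lebesgue) + (\<integral>\<^sup>+r\<in>{b<..}. ?f r \<partial>lebesgue) = \<infinity>"
    unfolding div by (simp add: top_unique)
  moreover have "(\<integral>\<^sup>+r\<in>{1..b}. ?f r \<partial>lebesgue) \<le> (\<integral>\<^sup>+r\<in>{1..b}. ennreal (\<rho> r) \<partial>lebesgue)"
  proof (rule nn_integral_mono)
    fix r :: real
    show "?f r * indicator {1..b} r \<le> ennreal (\<rho> r) * indicator {1..b} r"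
    proof (cases "r \<in> {1..b}")
      case True
      have "\<rho> r \<ge> 0"
      proof -
        obtain x :: "real^'n" where "norm x = r" using vector_choose_size[of r] True by auto
        thus ?thesis using nonneg[of x] radial[of x] by simp
      qed
      hence "\<rho> r / (1 + r\<^sup>2) \<le> \<rho> r / 1" by (intro divide_left_mono) (auto intro: add_pos_nonneg)
      thus ?thesis using True by (simp add: ennreal_leI)
    qed simp
  qed
  ultimately show ?thesis
    using radial_profile_integrable[OF loc nonneg radial b] by (auto simp: ennreal_add_eq_top)
qed

section \<open>Uniqueness\<close>

lemma fourier_orthogonal:
  fixes P :: "real^'n \<Rightarrow> real^'n"
  assumes P: "orthogonal_transformation P" and [measurable]: "g \<in> borel_measurable borel"
  shows "fourier (\<lambda>x. g (P x)) \<xi> = fourier g (P \<xi>)"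
proof -
  have [measurable]: "P \<in> borel_measurable borel" by (rule borel_measurable_orthogonal_transformation[OF P])
  have "fourier g (P \<xi>) = (LINT y|distr lborel borel P. g y * exp (- 2 * of_real pi * \<i> * of_real (y \<bullet> P \<xi>)))"
    unfolding distr_lborel_orthogonal[OF P] fourier_def ..
  also have "\<dots> = (LINT x|lborel. g (P x) * exp (- 2 * of_real pi * \<i> * of_real (P x \<bullet> P \<xi>)))"
    by (rule integral_distr) measurable
  also have "\<dots> = fourier (\<lambda>x. g (P x)) \<xi>"
    using P unfolding fourier_def orthogonal_transformation_def by simp
  finally show ?thesis ..
qed

lemma Ck_Suc_imp_continuous: "Ck (Suc k) g \<Longrightarrow> continuous_on UNIV g"
  by (auto intro: continuous_at_imp_continuous_on differentiable_imp_continuous_within)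

lemma matrix_zero_if_kernel_contains_frame:
  fixes A :: "real^'n^'n" and P :: "real^'n \<Rightarrow> real^'n"
  assumes P: "orthogonal_transformation P" and 0: "\<And>i. A *v P (axis i 1) = 0"
  shows "A = 0"
proof -
  have "A *v y = 0" for y
  proof -
    obtain x where y: "y = P x" using orthogonal_transformation_surj[OF P] by (metis surjD)
    have "x = (\<Sum>i\<in>UNIV. x $ i *\<^sub>R axis i 1)"
      using basis_expansion[of x] by (simp add: scalar_mult_eq_scaleR)
    hence "A *v y = A *v P (\<Sum>i\<in>UNIV. x $ i *\<^sub>R axis i 1)" unfolding y by simp
    also have "\<dots> = (\<Sum>i\<in>UNIV. x $ i *\<^sub>R (A *v P (axis i 1)))"
      by (simp add: linear_sum[OF orthogonal_transformation_linear[OF P]] linear_scale[OF orthogonal_transformation_linear[OF P]]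
        linear_sum[OF matrix_vector_mul_linear] matrix_vector_mult_scaleR)
    finally show ?thesis by (simp add: 0)
  qed
  thus ?thesis by (simp add: matrix_eq)
qed

theorem theorem4p1:
  fixes A :: "real^'n^'n"
    and f :: "real^'n \<Rightarrow> complex"
    and w :: "real^'n \<Rightarrow> real \<Rightarrow> complex"
    and \<psi> :: "real^'n \<Rightarrow> real"
    and \<rho> :: "real \<Rightarrow> real"
    and t0 C :: real
  assumes symmetric: "transpose A = A"
    and nonzero: "A \<noteq> 0"
    and f: "Cc_infinity f"
    and solution: "schroedinger_solution A f w"
    and nonneg: "\<And>x. \<psi> x \<ge> 0"
    and loc_int: "locally_integrable \<psi>"
    and radial: "\<And>x. \<psi> x = \<rho> (norm x)"
    and t0: "t0 \<noteq> 0"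
    and decay: "\<And>x. norm (w x t0) \<le> C * exp (- \<psi> x)"
    and divergence: "(\<integral>\<^sup>+ r\<in>{0..}. ennreal (\<rho> r / (1 + r\<^sup>2)) \<partial>lebesgue) = \<infinity>"
    and degenerate: "det A = 0 \<Longrightarrow>
          (\<integral>\<^sup>+ r\<in>{1..}. ennreal (\<rho> r / (1 + r\<^sup>2)) \<partial>lebesgue) = \<infinity>"
  shows "\<forall>x t. w x t = 0"
proof -
  define q where "q = (\<lambda>\<xi>::real^'n. \<Sum>i\<in>UNIV. \<Sum>j\<in>UNIV. A $ i $ j * \<xi> $ i * \<xi> $ j)"
  have cont_w: "continuous_on UNIV (\<lambda>x. w x t)" and int_w: "integrable lborel (\<lambda>x. w x t)"
    and fourier_w: "fourier (\<lambda>x. w x t) \<xi> = exp (- 4 * of_real (pi\<^sup>2) * \<i> * of_real t * of_real (q \<xi>)) * fourier f \<xi>" for t \<xi>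
    using solution Ck_Suc_imp_continuous[of 1 "\<lambda>x. w x t"]
    unfolding schroedinger_solution_def q_def by (auto simp: numeral_2_eq_2)
  have cont_f: "continuous_on UNIV f" using f unfolding Cc_infinity_def by (metis Ck.simps(1))
  have "bounded {x. f x \<noteq> 0}"
    using f unfolding Cc_infinity_def by (meson bounded_subset closure_subset compact_imp_bounded)
  then obtain R where R: "R > 0" "\<And>x. f x \<noteq> 0 \<Longrightarrow> norm x \<le> R"
    unfolding bounded_pos by blast
  obtain P \<mu> where P: "orthogonal_transformation P" "\<And>i. A *v P (axis i 1) = \<mu> i *\<^sub>R P (axis i 1)"
      "\<And>x::real^'n. P x \<bullet> (A *v P x) = (\<Sum>i\<in>UNIV. \<mu> i * (x $ i)\<^sup>2)"
    using symmetric_diagonalization[OF symmetric] by blast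
  have cont_P: "continuous_on UNIV P"
    using orthogonal_transformation_linear[OF P(1)] by (simp add: linear_continuous_on linear_conv_bounded_linear)
  have P_norm: "norm (P x) = norm x" for x by (rule orthogonal_transformation_norm[OF P(1)])
  \<comment> \<open>The problem in the eigenbasis of \<open>A\<close>.\<close>
  define u where "u = (\<lambda>x. w (P x) t0)"
  define f' where "f' = (\<lambda>x. f (P x))"
  define \<tau> where "\<tau> = (\<lambda>i. 4 * pi\<^sup>2 * t0 * \<mu> i)"
  have u: "continuous_on UNIV u" "integrable lborel u"
  proof -
    show "continuous_on UNIV u" unfolding u_def by (rule continuous_on_compose2[OF cont_w cont_P]) simp
    have "integrable (distr lborel borel P) (\<lambda>x. w x t0)" unfolding distr_lborel_orthogonal[OF P(1)] by (rule int_w)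
    thus "integrable lborel u" unfolding u_def
      by (subst (asm) integrable_distr_eq)
        (use borel_measurable_orthogonal_transformation[OF P(1)] borel_measurable_integrable[OF int_w] in auto)
  qed
  have f': "continuous_on UNIV f'" "\<And>y i. f' y \<noteq> 0 \<Longrightarrow> \<bar>y $ i\<bar> \<le> R"
  proof -
    show "continuous_on UNIV f'" unfolding f'_def by (rule continuous_on_compose2[OF cont_f cont_P]) simp
    fix y i assume "f' y \<noteq> 0"
    hence "norm y \<le> R" using R(2)[of "P y"] by (simp add: f'_def P_norm)
    thus "\<bar>y $ i\<bar> \<le> R" using component_le_norm_cart[of y i] by linarith
  qed
  have evol: "fourier u \<xi> = exp (- \<i> * of_real (\<Sum>i\<in>UNIV. \<tau> i * (\<xi> $ i)\<^sup>2)) * fourier f' \<xi>" for \<xi>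
  proof -
    have "q (P \<xi>) = P \<xi> \<bullet> (A *v P \<xi>)"
      by (simp add: q_def inner_vec_def matrix_vector_mult_def sum_distrib_left mult_ac)
    hence "q (P \<xi>) = (\<Sum>i\<in>UNIV. \<mu> i * (\<xi> $ i)\<^sup>2)" by (simp only: P(3))
    hence "(\<Sum>i\<in>UNIV. \<tau> i * (\<xi> $ i)\<^sup>2) = 4 * pi\<^sup>2 * t0 * q (P \<xi>)"
      by (simp add: \<tau>_def sum_distrib_left mult.assoc)
    hence "- 4 * of_real (pi\<^sup>2) * \<i> * of_real t0 * of_real (q (P \<xi>)) = - \<i> * of_real (\<Sum>i\<in>UNIV. \<tau> i * (\<xi> $ i)\<^sup>2)"
      by simp
    moreover have "fourier u \<xi> = fourier (\<lambda>x. w x t0) (P \<xi>)"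
      unfolding u_def using borel_measurable_integrable[OF int_w]
      by (intro fourier_orthogonal[OF P(1), where g = "\<lambda>x. w x t0"]) simp
    moreover have "fourier f' \<xi> = fourier f (P \<xi>)"
      unfolding f'_def by (intro fourier_orthogonal[OF P(1)] borel_measurable_continuous_onI cont_f)
    ultimately show ?thesis by (simp only: fourier_w)
  qed
  \<comment> \<open>The line \<open>x0 + s v\<close> has distance \<open>norm x0\<close> from the origin.\<close>
  have vanish: "u (x0 + s *\<^sub>R v) = 0"
    if v: "norm v = 1" "x0 \<bullet> v = 0" "\<And>i. \<tau> i = 0 \<Longrightarrow> v $ i = 0"
      and div: "(\<integral>\<^sup>+ r\<in>{norm x0<..}. ennreal (\<rho> r / (1 + r\<^sup>2)) \<partial>lebesgue) = \<infinity>" for x0 v :: "real^'n" and s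
  proof -
    obtain H K S where H: "H holomorphic_on UNIV" "\<And>z. norm (H z) \<le> K * exp (S * \<bar>Im z\<bar>)"
      "\<And>s::real. norm (H (of_real s)) = norm (u (x0 + s *\<^sub>R v))"
    proof (rule schroedinger_extends_along_lines[where ?x0.0 = x0, OF u f'(1) less_imp_le[OF R(1)] f'(2) evol v(3)])
      fix H K S
      assume a: "H holomorphic_on UNIV" "\<And>z. norm (H z) \<le> K * exp (S * \<bar>Im z\<bar>)"
        "\<And>s::real. norm (H (of_real s)) = norm (u (x0 + s *\<^sub>R v))"
      show thesis by (rule that[OF a])
    qed
    have "norm (H (of_real s)) \<le> C * exp (- \<rho> (sqrt (s\<^sup>2 + (norm x0)\<^sup>2)))" for s
    proof -
      have "(norm (x0 + s *\<^sub>R v))\<^sup>2 = s\<^sup>2 + (norm x0)\<^sup>2"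
      proof -
        have vv: "v \<bullet> v = 1" using v(1) by (simp only: norm_eq_1)
        have "(norm (x0 + s *\<^sub>R v))\<^sup>2 = x0 \<bullet> x0 + 2 * s * (x0 \<bullet> v) + s\<^sup>2 * (v \<bullet> v)"
          unfolding power2_norm_eq_inner
          by (simp add: inner_add_left inner_add_right inner_commute[of v x0] power2_eq_square distrib_left)
        thus ?thesis unfolding vv v(2) power2_norm_eq_inner[of x0] by simp
      qed
      hence "norm (P (x0 + s *\<^sub>R v)) = sqrt (s\<^sup>2 + (norm x0)\<^sup>2)"
        unfolding P_norm by (intro real_sqrt_unique[symmetric]) auto
      thus ?thesis using decay[of "P (x0 + s *\<^sub>R v)"] unfolding H(3) u_def radial by simp
    qed
    from exponential_type_vanishes_if_log_integral_diverges[OF H(1,2) norm_ge_zero this div, of "of_real s"]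
    show ?thesis using H(3)[of s] by simp
  qed
  have u0: "u x = 0" for x
  proof (cases "(\<integral>\<^sup>+ r\<in>{1..}. ennreal (\<rho> r / (1 + r\<^sup>2)) \<partial>lebesgue) = \<infinity>")
    case True
    \<comment> \<open>Divergence at infinity: use all lines in the direction of one eigenvector.\<close>
    obtain i where i: "\<mu> i \<noteq> 0"
      using matrix_zero_if_kernel_contains_frame[OF P(1), of A] nonzero P(2) by (metis scaleR_zero_left)
    define x0 where "x0 = x - x $ i *\<^sub>R axis i 1"
    have "u (x0 + x $ i *\<^sub>R axis i 1) = 0"
    proof (rule vanish)
      show "x0 \<bullet> axis i 1 = 0" by (simp add: x0_def inner_axis inner_diff_left)
      show "axis i (1::real) $ j = 0" if "\<tau> j = 0" for j using that i t0 by (auto simp: \<tau>_def axis_def)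
      show "(\<integral>\<^sup>+ r\<in>{norm x0<..}. ennreal (\<rho> r / (1 + r\<^sup>2)) \<partial>lebesgue) = \<infinity>"
        by (rule exterior_divergence[OF loc_int nonneg radial norm_ge_zero True])
    qed simp
    thus ?thesis by (simp add: x0_def)
  next
    case False
    \<comment> \<open>Divergence at the origin: only lines through the origin see it, but every direction is available.\<close>
    hence "det A \<noteq> 0" using degenerate by blast
    hence ker: "A *v x = 0 \<Longrightarrow> x = 0" for x
      by (metis invertible_det_nz invertible_def matrix_left_invertible_ker)
    have \<mu>0: "\<mu> i \<noteq> 0" for i
    proof
      assume "\<mu> i = 0"
      hence "P (axis i 1) = 0" using ker P(2)[of i] by simp
      thus False using P_norm[of "axis i 1"] by simp
    qed
    have div0: "(\<integral>\<^sup>+ r\<in>{norm (0::real^'n)<..}. ennreal (\<rho> r / (1 + r\<^sup>2)) \<partial>lebesgue) = \<infinity>"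
    proof -
      have "AE r in lebesgue. r \<noteq> (0::real)" by (intro AE_completion AE_lborel_singleton)
      hence "(\<integral>\<^sup>+ r\<in>{norm (0::real^'n)<..}. ennreal (\<rho> r / (1 + r\<^sup>2)) \<partial>lebesgue) =
          (\<integral>\<^sup>+ r\<in>{0..}. ennreal (\<rho> r / (1 + r\<^sup>2)) \<partial>lebesgue)"
        by (intro nn_integral_cong_AE) (auto elim!: eventually_mono split: split_indicator)
      thus ?thesis using divergence by simp
    qed
    obtain v where v: "norm v = 1" "x = norm x *\<^sub>R v"
    proof (cases "x = 0")
      case True
      show thesis by (rule that[of "axis undefined 1"]) (use True in simp_all)
    next
      case False
      show thesis by (rule that[of "x /\<^sub>R norm x"]) (use False in simp_all)
    qed
    have "u (0 + norm x *\<^sub>R v) = 0"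
      using v(1) \<mu>0 t0 by (intro vanish div0) (auto simp: \<tau>_def)
    thus ?thesis using v(2) by simp
  qed
  have w0: "w y t0 = 0" for y
  proof -
    obtain x where "y = P x" using orthogonal_transformation_surj[OF P(1)] by (metis surjD)
    thus ?thesis using u0[of x] by (simp add: u_def)
  qed
  have "fourier f \<xi> = 0" for \<xi>
    using fourier_w[of t0 \<xi>] by (simp add: w0 fourier_def[of "\<lambda>x. 0"])
  hence "w x t = 0" for x t
    by (intro fourier_zero_imp_zero[OF cont_w int_w]) (simp add: fourier_w)
  thus ?thesis by blast
qed

end
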